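(* Let $K_1(\lambda)\in\mathbb F[\lambda]^{m_1\times(n+m_1)}$ and $N_1(\lambda)\in\mathbb F[\lambda]^{n\times(n+m_1)}$ be a pair of dual minimal bases, and let $K_2(\lambda)\in\mathbb F[\lambda]^{m_2\times(m+m_2)}$ and $N_2(\lambda)\in\mathbb F[\lambda]^{m\times(m+m_2)}$ be another pair of dual minimal bases. Let $\ell>0$ and let $$\mathcal L(\lambda)=\begin{bmatrix} M(\lambda) & K_2(\lambda)^T\\ K_1(\lambda)&0\end{bmatrix}$$ be a block minimal bases degree-$\ell$ matrix polynomial. Consider the $m\times n$ matrix polynomial $Q(\lambda):=N_2(\lambda)M(\lambda)N_1(\lambda)^T$. Then: (a) $\mathcal L(\lambda)$ is an $\ell$-ification of $Q(\lambda)$. (b) If $\mathcal L(\lambda)$ is a strong block minimal bases degree-$\ell$ matrix polynomial, then $\mathcal L(\lambda)$ is a strong $\ell$-ification of $Q(\lambda)$, when $Q(\lambda)$ is considered as a polynomial with grade $\ell+\deg(N_1(\lambda))+\deg(N_2(\lambda))$.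
   Context: $\mathbb F$ is an arbitrary field. $\mathbb F[\lambda]^{p\times q}$ is the set of $p\times q$ matrix polynomials. A matrix polynomial has grade $d$ if it is written as $P(\lambda)=\sum_{i=0}^dP_i\lambda^i$ (any coefficient, including $P_d$, may be zero); its degree $\deg(P(\lambda))$ is the largest $i$ with $P_i\ne0$. For $d\ge\deg(P(\lambda))$, $\mathrm{rev}_dP(\lambda):=\lambda^dP(\lambda^{-1})$, considered with grade $d$. A square matrix polynomial is unimodular if its determinant is a nonzero constant. $\ell$-ifications: a matrix polynomial $L(\lambda)$ of degree $\ell>0$ is an $\ell$-ification of a matrix polynomial $P(\lambda)$ of grade $d$ if for some $s\ge0$ there are unimodular $U(\lambda),V(\lambda)$ with $U(\lambda)L(\lambda)V(\lambda)=\begin{bmatrix}I_s&0\\ 0&P(\lambda)\end{bmatrix}$. It is a strong $\ell$-ification if, additionally, $\mathrm{rev}_\ell L(\lambda)$ is an $\ell$-ification of $\mathrm{rev}_dP(\lambda)$. Minimal bases: a minimal (polynomial) basis of a subspace of $\mathbb F(\lambda)^q$ is a basis consisting of vector polynomials whose sum of degrees is least among all bases consisting of vector polynomials. A $p\times q$ matrix polynomial ($p<q$) is called a minimal basis if its rows form a minimal basis of the rational subspace they span. The $i$th row degree of a matrix polynomial is the degree of its $i$th row. $K(\lambda)\in\mathbb F[\lambda]^{p_1\times q}$ and $N(\lambda)\in\mathbb F[\lambda]^{p_2\times q}$ are dual minimal bases if $p_1+p_2=q$, $K(\lambda)N(\lambda)^T=0$, and both are minimal bases; one also says each is a minimal basis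 dual to the other. Block minimal bases: $\mathcal L(\lambda)=\begin{bmatrix}M(\lambda)&K_2(\lambda)^T\\ K_1(\lambda)&0\end{bmatrix}$, with $M(\lambda)$ an arbitrary matrix polynomial of grade $\ell$, is a block minimal bases degree-$\ell$ matrix polynomial if $K_1(\lambda)$ and $K_2(\lambda)$ are both minimal bases of degree $\ell$. It is a strong block minimal bases degree-$\ell$ matrix polynomial if, in addition, all row degrees of $K_1(\lambda)$ equal $\ell$, all row degrees of $K_2(\lambda)$ equal $\ell$, the row degrees of a minimal basis dual to $K_1(\lambda)$ are all equal, and the row degrees of a minimal basis dual to $K_2(\lambda)$ are all equal. The degenerate cases where exactly one of $K_1(\lambda),K_2(\lambda)$ is absent (i.e. $m_1=0$ or $m_2=0$) are allowed; then the conditions on the absent block are void, and the corresponding $N_1(\lambda)$ or $N_2(\lambda)$ is the identity matrix $I_n$ or $I_m$ (degree $0$). *)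

theory Defs
  imports
    "HOL-Computational_Algebra.Normalized_Fraction"
    "Jordan_Normal_Form.VS_Connect"
begin

text \<open>A matrix polynomial over the field \<open>'a\<close> is a matrix of type \<open>'a poly mat\<close>, and the field of
  rational functions is \<open>'a poly fract\<close>. Matrices with no rows or no columns are allowed.\<close>

definition mat_coeff :: "'a::zero poly mat \<Rightarrow> nat \<Rightarrow> 'a mat" where
  "mat_coeff P i = map_mat (\<lambda>p. coeff p i) P"

text \<open>Inserting \<open>0\<close> fixes the degree of the zero matrix polynomial to be \<open>0\<close>.\<close>
definition mat_degree :: "'a::zero poly mat \<Rightarrow> nat" where
  "mat_degree P = Max (insert 0 {i. mat_coeff P i \<noteq> 0\<^sub>m (dim_row P) (dim_col P)})"

lemma finite_mat_coeff: "finite {i. mat_coeff P i \<noteq> 0\<^sub>m (dim_row P) (dim_col P)}"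
proof (rule finite_subset)
  show "{i. mat_coeff P i \<noteq> 0\<^sub>m (dim_row P) (dim_col P)}
      \<subseteq> (\<Union>p\<in>elements_mat P. {..degree p})"
    by (auto simp: mat_coeff_def elements_mat_def mat_eq_iff dest!: le_degree)
      (metis atLeastLessThan_iff zero_le)
  show "finite (\<Union>p\<in>elements_mat P. {..degree p})"
    by (simp add: elements_mat_def)
qed

lemma mat_degree_le_iff:
  "mat_degree P \<le> d \<longleftrightarrow> (\<forall>i<dim_row P. \<forall>j<dim_col P. degree (P $$ (i, j)) \<le> d)"
proof -
  have "mat_degree P \<le> d \<longleftrightarrow> (\<forall>k>d. mat_coeff P k = 0\<^sub>m (dim_row P) (dim_col P))"
    unfolding mat_degree_def using finite_mat_coeff[of P] by (auto simp: Max_le_iff)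
  also have "\<dots> \<longleftrightarrow> (\<forall>i<dim_row P. \<forall>j<dim_col P. \<forall>k>d. coeff (P $$ (i, j)) k = 0)"
    by (auto simp: mat_coeff_def mat_eq_iff)
  also have "\<dots> \<longleftrightarrow> (\<forall>i<dim_row P. \<forall>j<dim_col P. degree (P $$ (i, j)) \<le> d)"
    by (meson degree_le coeff_eq_0 le_less_trans)
  finally show ?thesis .
qed

definition vec_degree :: "'a::zero poly vec \<Rightarrow> nat" where
  "vec_degree v = Max (insert 0 {i. map_vec (\<lambda>p. coeff p i) v \<noteq> 0\<^sub>v (dim_vec v)})"

text \<open>The reversal \<open>\<lambda>\<^sup>d p(\<lambda>\<^sup>-\<^sup>1)\<close>, meaningful for \<open>degree p \<le> d\<close>.\<close>
definition poly_rev :: "nat \<Rightarrow> 'a::comm_monoid_add poly \<Rightarrow> 'a poly" where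
  "poly_rev d p = (\<Sum>i\<le>d. monom (coeff p i) (d - i))"

definition mat_rev :: "nat \<Rightarrow> 'a::comm_monoid_add poly mat \<Rightarrow> 'a poly mat" where
  "mat_rev d P = map_mat (poly_rev d) P"

lemma poly_poly_rev:
  fixes x :: "'a::field"
  assumes "degree p \<le> d" "x \<noteq> 0"
  shows "poly (poly_rev d p) x = x ^ d * poly p (inverse x)"
proof -
  have "poly p (inverse x) = (\<Sum>i\<le>d. coeff p i * inverse x ^ i)"
    unfolding poly_altdef using assms(1)
    by (intro sum.mono_neutral_left) (auto simp: coeff_eq_0)
  moreover have "x ^ (d - i) = x ^ d * inverse x ^ i" if "i \<le> d" for i
    using assms(2) that by (simp add: power_diff power_inverse divide_inverse)
  ultimately show ?thesis
    by (simp add: poly_rev_def poly_sum poly_monom sum_distrib_left mult.left_commute)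
qed

definition unimodular :: "'a::field poly mat \<Rightarrow> bool" where
  "unimodular U \<longleftrightarrow> square_mat U \<and> (\<exists>c. c \<noteq> 0 \<and> det U = [:c:])"

definition lification :: "nat \<Rightarrow> 'a::field poly mat \<Rightarrow> 'a poly mat \<Rightarrow> bool" where
  "lification l L P \<longleftrightarrow> 0 < l \<and> mat_degree L = l \<and>
    (\<exists>s U V. U \<in> carrier_mat (dim_row L) (dim_row L) \<and> unimodular U \<and>
             V \<in> carrier_mat (dim_col L) (dim_col L) \<and> unimodular V \<and>
             U * L * V =
               four_block_mat (1\<^sub>m s) (0\<^sub>m s (dim_col P)) (0\<^sub>m (dim_row P) s) P)"

text \<open>\<open>strong_lification l d L P\<close>: here \<open>P\<close> is considered with grade \<open>d\<close>.\<close>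
definition strong_lification ::
    "nat \<Rightarrow> nat \<Rightarrow> 'a::field poly mat \<Rightarrow> 'a poly mat \<Rightarrow> bool" where
  "strong_lification l d L P \<longleftrightarrow> mat_degree P \<le> d \<and>
    lification l L P \<and> lification l (mat_rev l L) (mat_rev d P)"

text \<open>\<open>W\<close> is a set of vectors of rational functions of length \<open>q\<close>; a basis of vector polynomials
  is given before its embedding into the rational vectors. The existence of such a basis forces
  \<open>W\<close> to be a subspace.\<close>
definition polynomial_basis ::
    "nat \<Rightarrow> 'a::field poly fract vec set \<Rightarrow> 'a poly vec set \<Rightarrow> bool" where
  "polynomial_basis q W B \<longleftrightarrow> finite B \<and> B \<subseteq> carrier_vec q \<and>
    \<not> LinearCombinations.module.lin_dep class_ring (module_vec TYPE('a poly fract) q) (map_vec to_fract ` B) \<and>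
    LinearCombinations.module.span class_ring (module_vec TYPE('a poly fract) q) (map_vec to_fract ` B) = W"

definition minimal_polynomial_basis ::
    "nat \<Rightarrow> 'a::field poly fract vec set \<Rightarrow> 'a poly vec set \<Rightarrow> bool" where
  "minimal_polynomial_basis q W B \<longleftrightarrow> polynomial_basis q W B \<and>
    (\<forall>B'. polynomial_basis q W B' \<longrightarrow> sum vec_degree B \<le> sum vec_degree B')"

definition rational_row_space :: "'a::field poly mat \<Rightarrow> 'a poly fract vec set" where
  "rational_row_space K = vec_space.row_space (dim_col K) (map_mat to_fract K)"

text \<open>Distinctness of the rows is needed because a basis is modelled as a set.\<close>
definition minimal_basis :: "'a::field poly mat \<Rightarrow> bool" where
  "minimal_basis K \<longleftrightarrow> dim_row K < dim_col K \<and> distinct (rows K) \<and>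
    minimal_polynomial_basis (dim_col K) (rational_row_space K) (set (rows K))"

definition dual_minimal_bases :: "'a::field poly mat \<Rightarrow> 'a poly mat \<Rightarrow> bool" where
  "dual_minimal_bases K N \<longleftrightarrow>
    dim_col N = dim_col K \<and> dim_row K + dim_row N = dim_col K \<and>
    K * transpose_mat N = 0\<^sub>m (dim_row K) (dim_row N) \<and>
    minimal_basis K \<and> minimal_basis N"

text \<open>The block matrix with rows \<open>(M, K\<^sub>2\<^sup>T)\<close> and \<open>(K\<^sub>1, 0)\<close>.\<close>
definition block_mat ::
    "'a::field poly mat \<Rightarrow> 'a poly mat \<Rightarrow> 'a poly mat \<Rightarrow> 'a poly mat" where
  "block_mat M K1 K2 =
    four_block_mat M (transpose_mat K2) K1 (0\<^sub>m (dim_row K1) (dim_row K2))"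

text \<open>A block \<open>K\<^sub>1\<close> or \<open>K\<^sub>2\<close> is absent if it has no rows. At most one of them may be absent, and
  nothing is required of an absent block.\<close>
definition block_minimal_bases ::
    "nat \<Rightarrow> 'a::field poly mat \<Rightarrow> 'a poly mat \<Rightarrow> 'a poly mat \<Rightarrow> bool" where
  "block_minimal_bases l M K1 K2 \<longleftrightarrow>
    M \<in> carrier_mat (dim_col K2) (dim_col K1) \<and> mat_degree M \<le> l \<and>
    (dim_row K1 \<noteq> 0 \<or> dim_row K2 \<noteq> 0) \<and>
    (\<forall>K\<in>{K1, K2}. dim_row K \<noteq> 0 \<longrightarrow> minimal_basis K \<and> mat_degree K = l)"

definition row_degrees :: "'a::zero poly mat \<Rightarrow> nat list" where
  "row_degrees K = map vec_degree (rows K)"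

text \<open>The row degrees of a minimal basis dual to \<open>K\<close> do not depend, up to order, on the choice of
  that basis. Hence it is enough to demand equality of the row degrees of some dual basis.\<close>
definition strong_block_minimal_bases ::
    "nat \<Rightarrow> 'a::field poly mat \<Rightarrow> 'a poly mat \<Rightarrow> 'a poly mat \<Rightarrow> bool" where
  "strong_block_minimal_bases l M K1 K2 \<longleftrightarrow> block_minimal_bases l M K1 K2 \<and>
    (\<forall>K\<in>{K1, K2}. dim_row K \<noteq> 0 \<longrightarrow>
      (\<forall>e\<in>set (row_degrees K). e = l) \<and>
      (\<exists>N e. dual_minimal_bases K N \<and> (\<forall>e'\<in>set (row_degrees N). e' = e)))"

end

theory Submission
  imports Defs "Jordan_Normal_Form.DL_Rank"
begin

text \<open>
  Let \<open>K\<close> be a minimal basis with rows \<open>k\<^sub>i\<close> of degrees \<open>d\<^sub>i\<close>. If a vector polynomial \<open>w\<close> lies in the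
  rational row space of \<open>K\<close> and the coefficient of \<open>k\<^sub>i\<close> in \<open>w\<close> is nonzero, then \<open>k\<^sub>i\<close> may be exchanged
  for \<open>w\<close>, and minimality of the degree sum forces \<open>w\<close> to have degree at least \<open>d\<^sub>i\<close>. The proof draws
  only on this exchange property (\<open>minimal_rows\<close>, obtained in \<open>minimal_basis_minimal_rows\<close>).

  It first yields that \<open>K\<close> has a polynomial right inverse. If \<open>g w = a K\<close> with polynomial \<open>a\<close> and \<open>w\<close>,
  then reducing \<open>a\<close> modulo \<open>g\<close> produces a vector polynomial of too small a degree unless \<open>g\<close> divides
  \<open>a\<close> (\<open>minimal_rows_saturated\<close>). Among all \<open>X\<close> with \<open>det (K X) \<noteq> 0\<close> take one for which this
  determinant has minimal degree, and put \<open>H = K X\<close>. By Cramer's rule and division with remainder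
  every column of \<open>K\<close> is \<open>H\<close> times a vector polynomial, so \<open>K = H B\<close>. Saturation applied to
  \<open>adj(H) K = det(H) B\<close> shows that \<open>H\<close> is invertible over the polynomials, and \<open>X H\<^sup>-\<^sup>1\<close> is a right
  inverse (\<open>minimal_rows_right_inverse\<close>).

  Consequently, if \<open>K\<close> and \<open>N\<close> are dual, with right inverses \<open>X\<close> and \<open>Y\<close>, then the product of the
  matrix with block rows \<open>K\<close>, \<open>Y\<^sup>T\<close> and the matrix with block columns \<open>X\<close>, \<open>N\<^sup>T\<close> is block triangular
  with identity blocks on the diagonal, and both factors are unimodular
  (\<open>unimodular_dual_completion\<close>). Multiplying a stack of \<open>R\<close> over \<open>K\<close> on the right by the second
  factor turns it into \<open>(R X, R N\<^sup>T)\<close> over \<open>(1, 0)\<close>, and row operations reduce this to the block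
  diagonal matrix of \<open>1\<close> and \<open>R N\<^sup>T\<close> (\<open>stacked_equivalence\<close>). This step for \<open>K\<^sub>1\<close>, followed by the
  transposed step for \<open>K\<^sub>2\<close>, reduces the block matrix to the block diagonal matrix of \<open>1\<close> and
  \<open>N\<^sub>2 M N\<^sub>1\<^sup>T\<close> (\<open>block_mat_equivalence\<close>). This gives part (a).

  For part (b), reversing the identity \<open>g w = a K\<close> shows that the exchange property survives
  reversal if all rows of \<open>K\<close> have the same degree (\<open>minimal_rows_rev\<close>). Reversal is multiplicative,
  so the reversal of \<open>Q\<close> is formed from the reversals of \<open>N\<^sub>2\<close>, \<open>M\<close> and \<open>N\<^sub>1\<close>, and the argument for
  part (a) applies to the reversed blocks. The hypothesis on row degrees speaks of some dual basis
  of \<open>K\<^sub>1\<close>. Any two dual bases are related by polynomial matrices that are inverse to each other, and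
  the exchange property for both forces the row degrees of \<open>N\<^sub>1\<close> to agree with the common row degree
  of that basis (\<open>minimal_rows_uniform_degree\<close>). The same holds for \<open>K\<^sub>2\<close> and \<open>N\<^sub>2\<close>.
\<close>

section \<open>The exchange property of minimal bases\<close>

text \<open>The equation says that \<open>w\<close> is the combination of the rows of \<open>K\<close> with the rational coefficients
  \<open>a / g\<close>; clearing denominators keeps everything over the polynomials. The bounds \<open>d\<close> are a parameter
  so that one definition covers the actual row degrees of a minimal basis, the constant bounds needed
  for reversals, the identity matrix and the matrix without rows.\<close>
definition minimal_rows :: "(nat \<Rightarrow> nat) \<Rightarrow> 'a::field poly mat \<Rightarrow> bool" where
  "minimal_rows d K \<longleftrightarrow>
    (\<forall>i<dim_row K. \<forall>j<dim_col K. degree (K $$ (i, j)) \<le> d i) \<and>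
    (\<forall>g a w. g \<noteq> 0 \<longrightarrow> a \<in> carrier_vec (dim_row K) \<longrightarrow> w \<in> carrier_vec (dim_col K) \<longrightarrow>
       transpose_mat K *\<^sub>v a = g \<cdot>\<^sub>v w \<longrightarrow>
       (\<forall>i<dim_row K. a $ i \<noteq> 0 \<longrightarrow> (\<exists>j<dim_col K. w $ j \<noteq> 0 \<and> d i \<le> degree (w $ j))))"

lemma minimal_rows_degree_le:
  "minimal_rows d K \<Longrightarrow> i < dim_row K \<Longrightarrow> j < dim_col K \<Longrightarrow> degree (K $$ (i, j)) \<le> d i"
  by (simp add: minimal_rows_def)

lemma minimal_rowsE:
  assumes "minimal_rows d K" "K \<in> carrier_mat p q" "g \<noteq> 0" "a \<in> carrier_vec p" "w \<in> carrier_vec q"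
    "transpose_mat K *\<^sub>v a = g \<cdot>\<^sub>v w" "i < p" "a $ i \<noteq> 0"
  obtains j where "j < q" "w $ j \<noteq> 0" "d i \<le> degree (w $ j)"
proof -
  from assms(2) have "dim_row K = p" "dim_col K = q" by auto
  with assms show thesis using that unfolding minimal_rows_def by blast
qed

lemma index_transpose_mult_vec:
  fixes K :: "'a::comm_semiring_0 mat"
  assumes "K \<in> carrier_mat p q" "a \<in> carrier_vec p" "j < q"
  shows "(transpose_mat K *\<^sub>v a) $ j = (\<Sum>k<p. K $$ (k, j) * a $ k)"
  using assms by (auto simp: scalar_prod_def atLeast0LessThan intro!: sum.cong)

text \<open>The zero vector has no entry of degree at least \<open>d i\<close>, because the exchange property asks for a
  nonzero entry. So a combination of the rows that vanishes cannot involve any row.\<close>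
lemma minimal_rows_left_kernel:
  assumes "minimal_rows d K" "K \<in> carrier_mat p q" "a \<in> carrier_vec p"
    and "transpose_mat K *\<^sub>v a = 0\<^sub>v q"
  shows "a = 0\<^sub>v p"
proof (rule eq_vecI)
  fix i assume i: "i < dim_vec (0\<^sub>v p)"
  show "a $ i = 0\<^sub>v p $ i"
  proof (rule ccontr)
    assume "a $ i \<noteq> 0\<^sub>v p $ i"
    then have ai: "a $ i \<noteq> 0" using i by simp
    have "transpose_mat K *\<^sub>v a = 1 \<cdot>\<^sub>v 0\<^sub>v q" using assms(4) by simp
    from minimal_rowsE[OF assms(1,2) _ assms(3) _ this _ ai] i show False by auto
  qed
qed (use assms in auto)

text \<open>The exchange property for a row in place of itself shows that the bounds \<open>d\<close> are attained.\<close>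
lemma minimal_rows_row_degree:
  assumes min: "minimal_rows d K" and K: "K \<in> carrier_mat p q" and i: "i < p"
  obtains j where "j < q" "K $$ (i, j) \<noteq> 0" "degree (K $$ (i, j)) = d i"
proof -
  have "transpose_mat K *\<^sub>v unit_vec p i = 1 \<cdot>\<^sub>v row K i"
    using K i by (intro eq_vecI) auto
  from minimal_rowsE[OF min K _ _ _ this i] obtain j
    where "j < q" "row K i $ j \<noteq> 0" "d i \<le> degree (row K i $ j)"
    using K i by auto
  then show thesis
    using that minimal_rows_degree_le[OF min, of i j] K i by force
qed

text \<open>This covers the absent blocks, where the dual basis is the identity.\<close>
lemma minimal_rows_one: "minimal_rows (\<lambda>_. 0) (1\<^sub>m n :: 'a::field poly mat)"
proof -
  have "w $ i \<noteq> 0" if "a \<in> carrier_vec n" "w \<in> carrier_vec n" "a = g \<cdot>\<^sub>v w" "i < n" "a $ i \<noteq> 0"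
    for g :: "'a poly" and a w i
    using that by auto
  then show ?thesis by (auto simp: minimal_rows_def)
qed

lemma minimal_rows_mat_degree:
  assumes "minimal_rows (\<lambda>_. d) K" "dim_row K \<noteq> 0"
  shows "mat_degree K = d"
proof (rule antisym)
  show "mat_degree K \<le> d" using minimal_rows_degree_le[OF assms(1)] by (auto simp: mat_degree_le_iff)
  obtain j where "j < dim_col K" "degree (K $$ (0, j)) = d"
    using minimal_rows_row_degree[OF assms(1), of "dim_row K" "dim_col K" 0] assms(2) by auto
  then show "d \<le> mat_degree K" using mat_degree_le_iff[of K "mat_degree K"] assms(2) by auto
qed

lemma minimal_rows_cong:
  "(\<And>i. i < dim_row K \<Longrightarrow> d i = e i) \<Longrightarrow> minimal_rows d K \<longleftrightarrow> minimal_rows e K"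
  by (auto simp: minimal_rows_def)

lemma vec_degree_le_iff: "vec_degree v \<le> d \<longleftrightarrow> (\<forall>i<dim_vec v. degree (v $ i) \<le> d)"
proof -
  have "finite {k. map_vec (\<lambda>p. coeff p k) v \<noteq> 0\<^sub>v (dim_vec v)}"
  proof (rule finite_subset)
    show "{k. map_vec (\<lambda>p. coeff p k) v \<noteq> 0\<^sub>v (dim_vec v)} \<subseteq> (\<Union>i<dim_vec v. {..degree (v $ i)})"
      by (auto simp: vec_eq_iff dest!: le_degree)
  qed simp
  then have "vec_degree v \<le> d \<longleftrightarrow> (\<forall>k>d. map_vec (\<lambda>p. coeff p k) v = 0\<^sub>v (dim_vec v))"
    unfolding vec_degree_def by (auto simp: Max_le_iff)
  also have "\<dots> \<longleftrightarrow> (\<forall>i<dim_vec v. \<forall>k>d. coeff (v $ i) k = 0)"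
    by (auto simp: vec_eq_iff)
  also have "\<dots> \<longleftrightarrow> (\<forall>i<dim_vec v. degree (v $ i) \<le> d)"
    by (meson degree_le coeff_eq_0 le_less_trans)
  finally show ?thesis .
qed

text \<open>The Steinitz exchange of one basis vector \<open>v\<close> for a vector \<open>u\<close> in which \<open>v\<close> occurs with a nonzero
  coefficient.\<close>
lemma (in vec_space) basis_exchange:
  assumes E: "finite E" "E \<subseteq> carrier_vec n" and v: "v \<in> carrier_vec n" "v \<notin> E"
    and indpt: "lin_indpt (insert v E)"
    and e: "e \<in> span E" and c: "c \<noteq> 0" and u: "u = c \<cdot>\<^sub>v v + e"
  shows "u \<notin> span E" "lin_indpt (insert u E)" "span (insert u E) = span (insert v E)"
proof -
  have indE: "lin_indpt E" using subset_li_is_li[OF indpt] by blast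
  have vE: "v \<notin> span E"
    using lin_dep_iff_in_span[OF E(2) indE v] indpt by simp
  have spanE: "span E \<subseteq> carrier_vec n" using span_is_subset2[OF E(2)] .
  have ec: "e \<in> carrier_vec n" using e spanE by blast
  have uc: "u \<in> carrier_vec n" using u v ec by simp
  have v_eq: "v = inverse c \<cdot>\<^sub>v u + (- inverse c) \<cdot>\<^sub>v e"
    using c v ec unfolding u by (intro eq_vecI) (auto simp: field_simps)
  show uE: "u \<notin> span E"
  proof
    assume "u \<in> span E"
    then have "inverse c \<cdot>\<^sub>v u + (- inverse c) \<cdot>\<^sub>v e \<in> span E"
      by (intro span_add1[OF E(2)] smult_in_span[OF E(2)] e)
    with v_eq vE show False by simp
  qed
  then have "u \<notin> E" using span_mem[OF E(2)] by blast
  with lin_dep_iff_in_span[OF E(2) indE uc this] uE show "lin_indpt (insert u E)" by simp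
  have in_insert: "x \<in> span (insert y E)" if "y \<in> carrier_vec n" "x = a \<cdot>\<^sub>v y + b \<cdot>\<^sub>v e" for x y a b
  proof -
    have yE: "insert y E \<subseteq> carrier_vec n" using that(1) E by simp
    have "e \<in> span (insert y E)" using e span_is_monotone[of E "insert y E"] by blast
    moreover have "y \<in> span (insert y E)" using span_mem[OF yE] by blast
    ultimately show ?thesis unfolding that(2)
      by (intro span_add1[OF yE] smult_in_span[OF yE])
  qed
  have "u \<in> span (insert v E)" by (rule in_insert[OF v(1), of _ c 1]) (use u ec in simp)
  moreover have "v \<in> span (insert u E)" by (rule in_insert[OF uc v_eq])
  ultimately show "span (insert u E) = span (insert v E)"
    using span_swap[OF E uc uE v(1)] span_swap[OF E v(1) vE uc] by blast
qed

lemma map_vec_to_fract_mult: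
  fixes K :: "'a::field poly mat"
  assumes "K \<in> carrier_mat p q" "a \<in> carrier_vec q"
  shows "map_vec to_fract (K *\<^sub>v a) = map_mat to_fract K *\<^sub>v map_vec to_fract a"
  using assms by (intro eq_vecI) (auto simp: scalar_prod_def)

lemma inj_map_vec_to_fract: "inj (map_vec (to_fract :: 'a::idom \<Rightarrow> _))"
  by (auto simp: inj_def vec_eq_iff)

text \<open>If \<open>w\<close> violated the degree bound for row \<open>i\<close>, exchanging that row for \<open>w\<close> would give a polynomial
  basis of the same space with a smaller sum of degrees.\<close>
lemma minimal_basis_minimal_rows:
  fixes K :: "'a::field poly mat"
  assumes basis: "minimal_basis K"
  shows "minimal_rows (\<lambda>i. vec_degree (row K i)) K"
proof -
  define p q where "p = dim_row K" and "q = dim_col K"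
  have K: "K \<in> carrier_mat p q" and dims: "dim_row K = p" "dim_col K = q"
    by (simp_all add: p_def q_def)
  interpret vec_space "TYPE('a poly fract)" q .
  let ?F = "map_vec (to_fract :: 'a poly \<Rightarrow> 'a poly fract)"
  define W where "W = rational_row_space K"
  from basis have dist: "distinct (rows K)" and indpt: "lin_indpt (?F ` set (rows K))"
    and span: "span (?F ` set (rows K)) = W"
    and least: "\<And>B. polynomial_basis q W B \<Longrightarrow> sum vec_degree (set (rows K)) \<le> sum vec_degree B"
    by (auto simp: minimal_basis_def minimal_polynomial_basis_def polynomial_basis_def W_def dims)
  have "\<exists>j<q. w $ j \<noteq> 0 \<and> vec_degree (row K i) \<le> degree (w $ j)"
    if g: "g \<noteq> 0" and a: "a \<in> carrier_vec p" and w: "w \<in> carrier_vec q"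
      and eq: "transpose_mat K *\<^sub>v a = g \<cdot>\<^sub>v w" and i: "i < p" and ai: "a $ i \<noteq> 0"
    for g a w i
  proof (rule ccontr)
    assume "\<not> ?thesis"
    then have small: "w $ j = 0 \<or> degree (w $ j) < vec_degree (row K i)" if "j < q" for j
      using that by auto
    define v where "v = row K i"
    define R where "R = set (rows K) - {v}"
    have v: "v \<in> set (rows K)" using i K by (auto simp: v_def rows_def)
    have rows_eq: "set (rows K) = insert v R" using v by (auto simp: R_def)
    have Rc: "R \<subseteq> carrier_vec q" "v \<in> carrier_vec q" and finR: "finite R" and vR: "v \<notin> R"
      using K by (auto simp: R_def v_def rows_def)
    define A where "A = map_mat (to_fract :: 'a poly \<Rightarrow> 'a poly fract) (transpose_mat K)"
    define y where "y = inverse (to_fract g) \<cdot>\<^sub>v ?F a"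
    have A: "A \<in> carrier_mat q p" using K by (simp add: A_def)
    have y: "y \<in> carrier_vec p" using a by (simp add: y_def)
    have colsA: "cols A = map ?F (rows K)"
      using K by (intro nth_equalityI) (auto simp: A_def vec_eq_iff)
    have distA: "distinct (cols A)"
      unfolding colsA using dist inj_on_subset[OF inj_map_vec_to_fract subset_UNIV]
      by (simp add: distinct_map)
    have Ay: "A *\<^sub>v y = ?F w"
    proof -
      have "A *\<^sub>v ?F a = ?F (g \<cdot>\<^sub>v w)"
        unfolding eq[symmetric] A_def using K a
        by (intro map_vec_to_fract_mult[of _ q p, symmetric]) auto
      also have "\<dots> = to_fract g \<cdot>\<^sub>v ?F w" by (intro eq_vecI) auto
      finally show ?thesis
        unfolding y_def using A a g by (simp add: mult_mat_vec smult_smult_assoc)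
    qed
    \<comment> \<open>Linear combinations are indexed by vectors; since the rows are distinct, \<open>f\<close> reads off the
      coefficient of a row from its position.\<close>
    define f where "f = (\<lambda>x. y $ find_first x (cols A))"
    have Fv: "?F v = cols A ! i" "i < length (cols A)"
      unfolding colsA using i K by (auto simp: v_def)
    have fv: "f (?F v) = y $ i"
      unfolding f_def Fv(1) using find_first_unique[OF distA Fv(2)] by simp
    have setA: "set (cols A) = insert (?F v) (?F ` R)" unfolding colsA using rows_eq by auto
    have vR': "?F v \<notin> ?F ` R" using vR inj_map_vec_to_fract by (auto dest: injD)
    have Ec: "?F ` R \<subseteq> carrier_vec q" "?F v \<in> carrier_vec q" using Rc by auto
    have "?F w = lincomb f (insert (?F v) (?F ` R))"
      using lincomb_eq_mat_mult[OF A y distA] unfolding setA Ay f_def by simp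
    also have "\<dots> = f (?F v) \<cdot>\<^sub>v ?F v + lincomb f (?F ` R)"
      using lincomb_insert2[of "?F ` R" f "?F v"] finR Ec vR' by simp
    finally have Fw: "?F w = y $ i \<cdot>\<^sub>v ?F v + lincomb f (?F ` R)" unfolding fv .
    have "y $ i \<noteq> 0" using ai g i a by (simp add: y_def)
    have inspan: "lincomb f (?F ` R) \<in> span (?F ` R)"
      using finR by (intro in_spanI[OF refl]) auto
    have indpt': "lin_indpt (insert (?F v) (?F ` R))" using indpt unfolding rows_eq by simp
    note exchange = basis_exchange[OF finite_imageI[OF finR] Ec vR' indpt' inspan \<open>y $ i \<noteq> 0\<close> Fw]
    have "?F w \<notin> ?F ` R" using exchange(1) span_mem[OF Ec(1)] by blast
    then have wR: "w \<notin> R" by blast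
    have "w \<noteq> 0\<^sub>v q"
    proof
      assume "w = 0\<^sub>v q"
      then have "?F w = 0\<^sub>v q" by (auto simp: vec_eq_iff)
      with exchange(1) span_empty span_is_monotone[of "{}" "?F ` R"] show False by auto
    qed
    \<comment> \<open>A nonzero entry of \<open>w\<close> has smaller degree than \<open>v\<close>, so the degree of \<open>v\<close> is positive and the
      truncated subtraction below is harmless.\<close>
    then obtain j where "j < q" "w $ j \<noteq> 0" using w by (auto simp: vec_eq_iff)
    with small have pos: "0 < vec_degree v" by (fastforce simp: v_def)
    have "vec_degree w \<le> vec_degree v - 1"
      unfolding vec_degree_le_iff using small w pos by (fastforce simp: v_def)
    with pos have less: "vec_degree w < vec_degree v" by simp
    have "polynomial_basis q W (insert w R)"
      unfolding polynomial_basis_def using finR Rc w exchange(2,3) span unfolding rows_eq by simp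
    from least[OF this] have "sum vec_degree (insert v R) \<le> sum vec_degree (insert w R)"
      unfolding rows_eq .
    then show False using less finR vR wR by simp
  qed
  moreover have "degree (K $$ (i, j)) \<le> vec_degree (row K i)" if "i < p" "j < q" for i j
    using vec_degree_le_iff[of "row K i" "vec_degree (row K i)"] that K by auto
  ultimately show ?thesis unfolding minimal_rows_def dims by blast
qed

section \<open>Right inverses of minimal bases\<close>

text \<open>Replacing the coefficients \<open>a\<close> by their remainders \<open>r\<close> modulo \<open>g\<close> changes \<open>w\<close> by a polynomial
  combination of the rows. If \<open>r \<noteq> 0\<close>, the exchange property for the row of largest bound that occurs
  in \<open>r\<close> contradicts the degrees on both sides, since \<open>r\<close> has entries of degree less than \<open>degree g\<close>.\<close>
lemma minimal_rows_saturated: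
  fixes K :: "'a::field poly mat"
  assumes min: "minimal_rows d K" and K: "K \<in> carrier_mat p q" and g: "g \<noteq> 0"
    and a: "a \<in> carrier_vec p" and w: "w \<in> carrier_vec q"
    and eq: "transpose_mat K *\<^sub>v a = g \<cdot>\<^sub>v w" and i: "i < p"
  shows "g dvd a $ i"
proof -
  define r where "r = vec p (\<lambda>k. a $ k mod g)"
  define b where "b = vec p (\<lambda>k. a $ k div g)"
  define w' where "w' = w - transpose_mat K *\<^sub>v b"
  have r: "r \<in> carrier_vec p" and b: "b \<in> carrier_vec p" by (auto simp: r_def b_def)
  have w': "w' \<in> carrier_vec q"
    unfolding w'_def carrier_vec_def using K w by simp
  have w'j: "w' $ j = w $ j - (\<Sum>k<p. K $$ (k, j) * b $ k)" if "j < q" for j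
    using that K w index_transpose_mult_vec[OF K b that] by (auto simp: w'_def)
  have Kr: "(\<Sum>k<p. K $$ (k, j) * r $ k) = g * w' $ j" if j: "j < q" for j
  proof -
    have "(\<Sum>k<p. K $$ (k, j) * r $ k)
        = (\<Sum>k<p. K $$ (k, j) * a $ k - g * (K $$ (k, j) * b $ k))"
      by (intro sum.cong) (auto simp: r_def b_def minus_div_mult_eq_mod[symmetric] algebra_simps)
    also have "\<dots> = (transpose_mat K *\<^sub>v a) $ j - g * (\<Sum>k<p. K $$ (k, j) * b $ k)"
      using index_transpose_mult_vec[OF K a j] by (simp add: sum_subtractf sum_distrib_left)
    also have "\<dots> = g * w' $ j"
      using w j unfolding eq w'j[OF j] by (simp add: algebra_simps)
    finally show ?thesis .
  qed
  have eq': "transpose_mat K *\<^sub>v r = g \<cdot>\<^sub>v w'"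
    using K w' Kr index_transpose_mult_vec[OF K r] by (intro eq_vecI) auto
  have "r $ i = 0"
  proof (rule ccontr)
    assume ri: "r $ i \<noteq> 0"
    define S where "S = {k. k < p \<and> r $ k \<noteq> 0}"
    have S: "finite S" "S \<noteq> {}" using ri i by (auto simp: S_def)
    obtain m where m: "m \<in> S" and max: "\<And>k. k \<in> S \<Longrightarrow> d k \<le> d m"
      using Max_in[of "d ` S"] Max_ge[of "d ` S"] S by fastforce
    from m have "m < p" "r $ m \<noteq> 0" by (auto simp: S_def)
    from minimal_rowsE[OF min K g r w' eq' this]
    obtain j where j: "j < q" "w' $ j \<noteq> 0" "d m \<le> degree (w' $ j)" .
    have small: "degree (r $ k) < degree g" if "k \<in> S" for k
      using that degree_mod_less'[OF g, of "a $ k"] by (auto simp: S_def r_def)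
    have "degree (\<Sum>k<p. K $$ (k, j) * r $ k) \<le> degree g + d m - 1"
    proof (rule degree_sum_le)
      fix k assume k: "k \<in> {..<p}"
      show "degree (K $$ (k, j) * r $ k) \<le> degree g + d m - 1"
      proof (cases "k \<in> S")
        case True
        have "degree (K $$ (k, j)) \<le> d m"
          using minimal_rows_degree_le[OF min, of k j] max[OF True] k j K by auto
        with small[OF True] degree_mult_le[of "K $$ (k, j)" "r $ k"] show ?thesis by linarith
      next
        case False
        then show ?thesis using k by (auto simp: S_def)
      qed
    qed simp
    moreover have "degree (g * w' $ j) = degree g + degree (w' $ j)"
      using g j by (simp add: degree_mult_eq)
    ultimately show False using Kr[OF j(1)] j(3) small[OF m] by simp
  qed
  then show ?thesis using i by (simp add: r_def mod_eq_0_iff_dvd)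
qed

text \<open>Full row rank without passing to the fraction field. In the induction step \<open>X'\<close> serves the first
  \<open>p\<close> rows. Appending the unit vector \<open>e\<^sub>j\<close> to it as a last column and expanding along that column,
  the determinant becomes entry \<open>j\<close> of \<open>cK\<close>, where the cofactors \<open>c\<close> do not depend on \<open>j\<close>. As \<open>c\<close>
  is nonzero, some entry of \<open>cK\<close> is nonzero.\<close>
lemma left_kernel_zero_det_nonzero:
  fixes K :: "'a::idom mat"
  assumes "K \<in> carrier_mat p q"
    and "\<And>a. a \<in> carrier_vec p \<Longrightarrow> transpose_mat K *\<^sub>v a = 0\<^sub>v q \<Longrightarrow> a = 0\<^sub>v p"
  shows "\<exists>X\<in>carrier_mat q p. det (K * X) \<noteq> 0"
  using assms
proof (induction p arbitrary: K)
  case 0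
  have "K * 0\<^sub>m q 0 \<in> carrier_mat 0 0"
    by (rule mult_carrier_mat[OF 0(1)]) simp
  from det_dim_zero[OF this] have "det (K * 0\<^sub>m q 0) \<noteq> 0" by (simp only: one_neq_zero not_False_eq_True)
  then show ?case by (intro bexI[of _ "0\<^sub>m q 0"]) simp_all
next
  case (Suc p K)
  note K = Suc.prems(1)
  define K' where "K' = mat p q (\<lambda>(i, j). K $$ (i, j))"
  have K': "K' \<in> carrier_mat p q" by (simp add: K'_def)
  have "a = 0\<^sub>v p" if a: "a \<in> carrier_vec p" and "transpose_mat K' *\<^sub>v a = 0\<^sub>v q" for a
  proof -
    define b where "b = vec (Suc p) (\<lambda>i. if i < p then a $ i else 0)"
    have b: "b \<in> carrier_vec (Suc p)" by (simp add: b_def)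
    have "transpose_mat K *\<^sub>v b = transpose_mat K' *\<^sub>v a"
      using K K' index_transpose_mult_vec[OF K b] index_transpose_mult_vec[OF K' a]
      by (intro eq_vecI) (auto simp: b_def K'_def)
    with Suc.prems(2)[OF b] that have "b = 0\<^sub>v (Suc p)" by simp
    then show ?thesis using a
      by (intro eq_vecI) (auto simp: b_def vec_eq_iff less_Suc_eq)
  qed
  from Suc.IH[OF K' this] obtain X' where X': "X' \<in> carrier_mat q p" and det': "det (K' * X') \<noteq> 0"
    by blast
  define B where
    "B = (\<lambda>x. mat (Suc p) (Suc p) (\<lambda>(i, k). if k < p then (K * X') $$ (i, k) else x i))"
  define X where
    "X = (\<lambda>j. mat q (Suc p) (\<lambda>(i, k). if k < p then X' $$ (i, k) else if i = j then 1 else 0))"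
  define c where "c = vec (Suc p) (\<lambda>i. cofactor (B (\<lambda>_. 0)) i p)"
  have B: "B x \<in> carrier_mat (Suc p) (Suc p)" for x by (simp add: B_def)
  have c: "c \<in> carrier_vec (Suc p)" by (simp add: c_def)
  have cofactor_B: "cofactor (B x) i p = c $ i" if "i < Suc p" for x i
  proof -
    have "mat_delete (B x) i p = mat_delete (B (\<lambda>_. 0)) i p"
      by (rule eq_matI) (auto simp: mat_delete_def B_def)
    then show ?thesis using that by (simp add: c_def cofactor_def)
  qed
  have KX: "K * X j = B (\<lambda>i. K $$ (i, j))" if "j < q" for j
  proof (rule eq_matI)
    fix i k assume "i < dim_row (B (\<lambda>i. K $$ (i, j)))" "k < dim_col (B (\<lambda>i. K $$ (i, j)))"
    then have ik: "i < Suc p" "k < Suc p" by (simp_all add: B_def)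
    have "(K * X j) $$ (i, k) = (\<Sum>l<q. K $$ (i, l) * X j $$ (l, k))"
      using ik K by (auto simp: X_def scalar_prod_def atLeast0LessThan intro!: sum.cong)
    also have "\<dots> = B (\<lambda>i. K $$ (i, j)) $$ (i, k)"
    proof (cases "k < p")
      case True
      then show ?thesis using ik K X'
        by (auto simp: B_def X_def scalar_prod_def atLeast0LessThan intro!: sum.cong)
    next
      case False
      then have "(\<Sum>l<q. K $$ (i, l) * X j $$ (l, k)) = (\<Sum>l<q. if l = j then K $$ (i, l) else 0)"
        using ik by (intro sum.cong) (auto simp: X_def)
      then show ?thesis using False ik that by (simp add: B_def)
    qed
    finally show "(K * X j) $$ (i, k) = B (\<lambda>i. K $$ (i, j)) $$ (i, k)" .
  qed (use K in \<open>auto simp: B_def X_def\<close>)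
  have det_KX: "det (K * X j) = (transpose_mat K *\<^sub>v c) $ j" if j: "j < q" for j
  proof -
    have "det (K * X j) = (\<Sum>i<Suc p. B (\<lambda>i. K $$ (i, j)) $$ (i, p) * cofactor (B (\<lambda>i. K $$ (i, j))) i p)"
      unfolding KX[OF j] by (rule laplace_expansion_column[OF B]) simp
    also have "\<dots> = (\<Sum>i<Suc p. K $$ (i, j) * c $ i)"
      by (intro sum.cong refl) (simp only: cofactor_B lessThan_iff, simp add: B_def)
    finally show ?thesis unfolding index_transpose_mult_vec[OF K c j] .
  qed
  have "mat_delete (B (\<lambda>_. 0)) p p = K' * X'"
    using K K' X' by (intro eq_matI)
      (auto simp: mat_delete_def B_def K'_def scalar_prod_def intro!: sum.cong)
  then have "c $ p \<noteq> 0" using det' by (simp add: c_def cofactor_def)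
  then have "c \<noteq> 0\<^sub>v (Suc p)" by auto
  with Suc.prems(2)[OF c] have "transpose_mat K *\<^sub>v c \<noteq> 0\<^sub>v q" by blast
  then obtain j where j: "j < q" "(transpose_mat K *\<^sub>v c) $ j \<noteq> 0"
    using K by (auto simp: vec_eq_iff)
  have "X j \<in> carrier_mat q (Suc p)" by (simp add: X_def)
  with det_KX[OF j(1)] j(2) show ?case by (intro bexI[of _ "X j"]) auto
qed

lemma mult_mat_smult_vec:
  fixes A :: "'a::comm_ring mat"
  assumes "A \<in> carrier_mat p q" "v \<in> carrier_vec q"
  shows "A *\<^sub>v (k \<cdot>\<^sub>v v) = k \<cdot>\<^sub>v (A *\<^sub>v v)"
  using assms by (intro eq_vecI) auto

lemma scalar_mat_mult_vec:
  fixes v :: "'a::comm_ring_1 vec"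
  assumes "v \<in> carrier_vec n"
  shows "(c \<cdot>\<^sub>m 1\<^sub>m n) *\<^sub>v v = c \<cdot>\<^sub>v v"
proof (rule eq_vecI)
  fix i assume "i < dim_vec (c \<cdot>\<^sub>v v)"
  then have i: "i < n" using assms by simp
  have "row (c \<cdot>\<^sub>m 1\<^sub>m n) i = c \<cdot>\<^sub>v unit_vec n i" using i by (intro eq_vecI) auto
  then show "((c \<cdot>\<^sub>m 1\<^sub>m n) *\<^sub>v v) $ i = (c \<cdot>\<^sub>v v) $ i" using i assms by simp
qed (use assms in simp)

text \<open>The columns of \<open>H = K * X\<close> span a submodule of full rank in the column module of \<open>K\<close>. Its
  codimension in the free module is the degree of \<open>det H\<close>, so minimality of this degree makes the two
  modules equal. Saturation then shows that they are the whole free module.\<close>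
lemma minimal_rows_right_inverse:
  fixes K :: "'a::field poly mat"
  assumes min: "minimal_rows d K" and K: "K \<in> carrier_mat p q"
  shows "\<exists>X\<in>carrier_mat q p. K * X = 1\<^sub>m p"
proof -
  define good where "good = (\<lambda>X. X \<in> carrier_mat q p \<and> det (K * X) \<noteq> 0)"
  have "\<exists>X. good X"
    using left_kernel_zero_det_nonzero[OF K minimal_rows_left_kernel[OF min K]] by (auto simp: good_def)
  then obtain X where X: "good X"
    and least: "\<And>X'. good X' \<Longrightarrow> degree (det (K * X)) \<le> degree (det (K * X'))"
    using ex_has_least_nat[of good _ "\<lambda>X. degree (det (K * X))"] by blast
  define H where "H = K * X"
  define h where "h = det H"
  from X have Xc: "X \<in> carrier_mat q p" and h0: "h \<noteq> 0" by (auto simp: good_def h_def H_def)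
  have H: "H \<in> carrier_mat p p" using K Xc by (simp add: H_def)
  have column: "\<exists>b\<in>carrier_vec p. col K j = H *\<^sub>v b" if j: "j < q" for j
  proof -
    \<comment> \<open>By Cramer's rule \<open>y / h\<close> solves \<open>H x = col K j\<close> over the rational functions; \<open>b\<close> and \<open>r\<close> are its
      polynomial part and the numerators of its fractional part.\<close>
    define y where "y = adj_mat H *\<^sub>v col K j"
    define b where "b = vec p (\<lambda>i. y $ i div h)"
    define r where "r = vec p (\<lambda>i. y $ i mod h)"
    define z where "z = unit_vec q j - X *\<^sub>v b"
    have k: "col K j \<in> carrier_vec p" using K j by (metis carrier_matD(1) col_dim)
    have y: "y \<in> carrier_vec p" using adj_mat(1)[OF H] k by (simp add: y_def)
    have b: "b \<in> carrier_vec p" and r: "r \<in> carrier_vec p" by (auto simp: b_def r_def)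
    have Xb: "X *\<^sub>v b \<in> carrier_vec q" using Xc b by simp
    have z: "z \<in> carrier_vec q" using Xb by (simp add: z_def)
    have Hy: "H *\<^sub>v y = h \<cdot>\<^sub>v col K j"
    proof -
      have "H *\<^sub>v y = (H * adj_mat H) *\<^sub>v col K j"
        unfolding y_def using H adj_mat(1)[OF H] k by simp
      also have "\<dots> = h \<cdot>\<^sub>v col K j"
        unfolding adj_mat(2)[OF H] h_def by (rule scalar_mat_mult_vec[OF k])
      finally show ?thesis .
    qed
    have yb: "y = h \<cdot>\<^sub>v b + r"
      using y by (intro eq_vecI) (auto simp: b_def r_def)
    have Ke: "K *\<^sub>v unit_vec q j = col K j" using K j by (intro eq_vecI) auto
    have Kz: "K *\<^sub>v z = col K j - H *\<^sub>v b"
      unfolding z_def H_def using K Xc b Xb j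
      by (simp add: mult_minus_distrib_mat_vec Ke)
    have Hr: "H *\<^sub>v r = h \<cdot>\<^sub>v (K *\<^sub>v z)"
    proof -
      have "h \<cdot>\<^sub>v col K j = h \<cdot>\<^sub>v (H *\<^sub>v b) + H *\<^sub>v r"
        unfolding Hy[symmetric] yb using H b r
        by (simp add: mult_add_distrib_mat_vec mult_mat_smult_vec)
      then have "H *\<^sub>v r = h \<cdot>\<^sub>v col K j - h \<cdot>\<^sub>v (H *\<^sub>v b)"
        using H b r k K by (auto simp: vec_eq_iff)
      then show ?thesis unfolding Kz using H b k K by (auto simp: vec_eq_iff algebra_simps)
    qed
    have "r $ i = 0" if i: "i < p" for i
    proof (rule ccontr)
      assume ri: "r $ i \<noteq> 0"
      \<comment> \<open>Trading column \<open>i\<close> of \<open>X\<close> for \<open>z\<close> changes the determinant of \<open>K * X\<close> from \<open>h\<close> to \<open>r $ i\<close>, whose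
        degree is smaller.\<close>
      define X' where "X' = replace_col X z i"
      have X': "X' \<in> carrier_mat q p" using Xc by (simp add: X'_def replace_col_def)
      have KX': "replace_col H (K *\<^sub>v z) i = K * X'"
      proof (rule eq_matI)
        fix s t assume "s < dim_row (K * X')" "t < dim_col (K * X')"
        then have st: "s < p" "t < p" using K X' by auto
        have "col X' t = (if t = i then z else col X t)"
          using Xc z st by (auto simp: X'_def replace_col_def vec_eq_iff)
        then show "replace_col H (K *\<^sub>v z) i $$ (s, t) = (K * X') $$ (s, t)"
          using st H K X' Xc by (auto simp: replace_col_def H_def)
      qed (use H K X' in \<open>auto simp: replace_col_def\<close>)
      have "r $ i * h = det (replace_col H (h \<cdot>\<^sub>v (K *\<^sub>v z)) i)"
        using cramer_lemma_mat[OF H r i] unfolding Hr h_def by simp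
      also have "replace_col H (h \<cdot>\<^sub>v (K *\<^sub>v z)) i =
          transpose_mat (multrow i h (transpose_mat (K * X')))"
        unfolding KX'[symmetric] using H K z by (intro eq_matI) (auto simp: replace_col_def)
      also have "det \<dots> = h * det (K * X')"
        using det_multrow[OF i, of "transpose_mat (K * X')" h] K X'
          det_transpose[of "K * X'" p] det_transpose[of "multrow i h (transpose_mat (K * X'))" p]
        by simp
      finally have ri': "r $ i = det (K * X')" using h0 by simp
      then have "good X'" using X' ri by (simp add: good_def)
      from least[OF this] have "degree h \<le> degree (r $ i)" unfolding ri' h_def H_def .
      moreover have "degree (r $ i) < degree h"
        using degree_mod_less'[OF h0, of "y $ i"] ri i by (simp add: r_def)
      ultimately show False by simp
    qed
    then have "r = 0\<^sub>v p" using r by auto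
    then have "y = h \<cdot>\<^sub>v b" using yb b by simp
    then have "h \<cdot>\<^sub>v col K j = h \<cdot>\<^sub>v (H *\<^sub>v b)"
      using Hy H b by (simp add: mult_mat_smult_vec)
    then have "col K j = H *\<^sub>v b"
      using h0 k H K by (auto simp: vec_eq_iff)
    with b show ?thesis by blast
  qed
  then obtain b where b: "\<And>j. j < q \<Longrightarrow> b j \<in> carrier_vec p" "\<And>j. j < q \<Longrightarrow> col K j = H *\<^sub>v b j"
    by metis
  define B where "B = mat p q (\<lambda>(i, j). b j $ i)"
  have B: "B \<in> carrier_mat p q" by (simp add: B_def)
  have colB: "col B j = b j" if "j < q" for j
    using b(1)[OF that] that by (auto simp: B_def)
  have KHB: "K = H * B"
  proof (intro eq_matI)
    fix i j assume "i < dim_row (H * B)" "j < dim_col (H * B)"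
    then have ij: "i < p" "j < q" using H B by auto
    have "K $$ (i, j) = col K j $ i" using ij K by simp
    also have "\<dots> = row H i \<bullet> b j" unfolding b(2)[OF ij(2)] using ij H by simp
    finally show "K $$ (i, j) = (H * B) $$ (i, j)"
      using ij H B colB[OF ij(2)] by simp
  qed (use K H B in auto)
  \<comment> \<open>Dividing \<open>adj_mat H\<close> by \<open>h\<close>, which saturation permits, gives the inverse \<open>C\<close> of \<open>H\<close>.\<close>
  define A where "A = adj_mat H"
  have A: "A \<in> carrier_mat p p" "H * A = h \<cdot>\<^sub>m 1\<^sub>m p" "A * H = h \<cdot>\<^sub>m 1\<^sub>m p"
    using adj_mat[OF H] by (simp_all add: A_def h_def)
  have AK: "A * K = h \<cdot>\<^sub>m B"
  proof -
    have "A * K = (A * H) * B" unfolding KHB using A(1) H B by simp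
    then show ?thesis unfolding A(3)
      using B mult_smult_assoc_mat[of "1\<^sub>m p" p p B q h] by simp
  qed
  have dvd: "h dvd A $$ (s, i)" if s: "s < p" and i: "i < p" for s i
  proof -
    have "transpose_mat K *\<^sub>v row A s = h \<cdot>\<^sub>v row B s"
    proof (rule eq_vecI)
      fix j assume "j < dim_vec (h \<cdot>\<^sub>v row B s)"
      then have j: "j < q" using B by simp
      have "(transpose_mat K *\<^sub>v row A s) $ j = (A * K) $$ (s, j)"
        using j s A(1) K by (auto simp: scalar_prod_def intro!: sum.cong)
      then show "(transpose_mat K *\<^sub>v row A s) $ j = (h \<cdot>\<^sub>v row B s) $ j"
        unfolding AK using j s B by simp
    qed (use K B in auto)
    from minimal_rows_saturated[OF min K h0 _ _ this i] show ?thesis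
      using A(1) B s i by simp
  qed
  define C where "C = map_mat (\<lambda>x. x div h) A"
  have C: "C \<in> carrier_mat p p" using A(1) by (simp add: C_def)
  have AC: "A = h \<cdot>\<^sub>m C" using A(1) dvd by (intro eq_matI) (auto simp: C_def)
  have "h \<cdot>\<^sub>m (H * C) = h \<cdot>\<^sub>m 1\<^sub>m p"
    using A(2) H C unfolding AC by (simp add: mult_smult_distrib)
  then have "H * C = 1\<^sub>m p" using h0 H C by (auto simp: mat_eq_iff)
  then have "K * (X * C) = 1\<^sub>m p" using K Xc C by (simp add: H_def)
  then show ?thesis using Xc C by (intro bexI[of _ "X * C"]) auto
qed

section \<open>Unimodular matrices and dual pairs\<close>

lemma unimodular_iff_unit_det: "unimodular U \<longleftrightarrow> square_mat U \<and> is_unit (det U)"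
  by (auto simp: unimodular_def is_unit_poly_iff dvd_field_iff)

lemma unimodular_mult:
  assumes "U \<in> carrier_mat n n" "V \<in> carrier_mat n n" "unimodular U" "unimodular V"
  shows "unimodular (U * V)"
  using assms by (auto simp: unimodular_iff_unit_det det_mult)

lemma unimodular_transpose:
  assumes "U \<in> carrier_mat n n" "unimodular U"
  shows "unimodular (transpose_mat U)"
  using assms by (auto simp: unimodular_iff_unit_det det_transpose)

lemma unimodular_of_mult:
  assumes "U \<in> carrier_mat n n" "V \<in> carrier_mat n n" "is_unit (det (U * V))"
  shows "unimodular U" "unimodular V"
  using assms by (auto simp: unimodular_iff_unit_det det_mult is_unit_mult_iff)

lemma unimodular_block_diag:
  assumes "U \<in> carrier_mat n n" "unimodular U"
  shows "unimodular (four_block_mat (1\<^sub>m p) (0\<^sub>m p n) (0\<^sub>m n p) U)"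
  using assms det_four_block_mat_upper_right_zero[of "1\<^sub>m p" p "0\<^sub>m p n" n "0\<^sub>m n p" U]
  by (auto simp: unimodular_iff_unit_det)

text \<open>The product of the second matrix with the first is block lower triangular with identity blocks on
  the diagonal, hence has determinant \<open>1\<close>. Blocks without rows or columns encode the two-block
  matrices.\<close>
lemma unimodular_dual_completion:
  fixes K N X Y :: "'a::field poly mat"
  assumes K: "K \<in> carrier_mat p (p + r)" and N: "N \<in> carrier_mat r (p + r)"
    and X: "X \<in> carrier_mat (p + r) p" and Y: "Y \<in> carrier_mat (p + r) r"
    and KX: "K * X = 1\<^sub>m p" and NY: "N * Y = 1\<^sub>m r"
    and KN: "K * transpose_mat N = 0\<^sub>m p r"
  shows "unimodular (four_block_mat X (transpose_mat N) (0\<^sub>m 0 p) (0\<^sub>m 0 r))"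
    and "unimodular (four_block_mat K (0\<^sub>m p 0) (transpose_mat Y) (0\<^sub>m r 0))"
proof -
  let ?V = "four_block_mat X (transpose_mat N) (0\<^sub>m 0 p) (0\<^sub>m 0 r)"
  let ?W = "four_block_mat K (0\<^sub>m p 0) (transpose_mat Y) (0\<^sub>m r 0)"
  have V: "?V \<in> carrier_mat (p + r) (p + r)"
    using four_block_carrier_mat[OF X, of "0\<^sub>m 0 r" 0 r] by simp
  have W: "?W \<in> carrier_mat (p + r) (p + r)"
    using four_block_carrier_mat[OF K, of "0\<^sub>m r 0" r 0] by simp
  have YN: "transpose_mat Y * transpose_mat N = 1\<^sub>m r"
    using transpose_mult[OF N Y] NY by simp
  have "?W * ?V = four_block_mat (K * X) (K * transpose_mat N)
      (transpose_mat Y * X) (transpose_mat Y * transpose_mat N)"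
    using K N X Y by (subst mult_four_block_mat[of _ p "p + r" _ 0 _ r _ _ p _ r]) auto
  also have "det \<dots> = 1"
    unfolding KX KN YN using X Y
    by (subst det_four_block_mat_upper_right_zero[of _ p _ r]) auto
  finally have "is_unit (det (?W * ?V))" by simp
  from unimodular_of_mult[OF W V this] show "unimodular ?V" "unimodular ?W" by auto
qed

section \<open>Row degrees of dual minimal bases\<close>

lemma mult_left_cancel_mat:
  fixes W :: "'a::idom mat"
  assumes W: "W \<in> carrier_mat n n" and "det W \<noteq> 0"
    and A: "A \<in> carrier_mat n t" and B: "B \<in> carrier_mat n t" and eq: "W * A = W * B"
  shows "A = B"
proof -
  have cancel: "adj_mat W * (W * C) = det W \<cdot>\<^sub>m C" if C: "C \<in> carrier_mat n t" for C
  proof -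
    have "adj_mat W * (W * C) = (adj_mat W * W) * C"
      using adj_mat(1)[OF W] W C by simp
    also have "\<dots> = det W \<cdot>\<^sub>m C"
      unfolding adj_mat(3)[OF W] using C mult_smult_assoc_mat[of "1\<^sub>m n" n n C t "det W"] by simp
    finally show ?thesis .
  qed
  have "det W \<cdot>\<^sub>m A = det W \<cdot>\<^sub>m B"
    unfolding cancel[OF A, symmetric] cancel[OF B, symmetric] eq ..
  then show ?thesis using A B \<open>det W \<noteq> 0\<close> by (auto simp: mat_eq_iff)
qed

text \<open>The rows of \<open>N\<close> generate, over the polynomials, everything that \<open>K\<close> annihilates. Indeed \<open>N'\<^sup>T\<close> and
  \<open>N\<^sup>T * T\<close> with \<open>T = Y\<^sup>T * N'\<^sup>T\<close> have the same image under the nonsingular matrix formed by \<open>K\<close> and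
  \<open>Y\<^sup>T\<close>.\<close>
lemma minimal_rows_change_basis:
  fixes K N N' :: "'a::field poly mat"
  assumes K: "K \<in> carrier_mat p (p + r)" and minK: "minimal_rows k K"
    and N: "N \<in> carrier_mat r (p + r)" and minN: "minimal_rows e N"
    and KN: "K * transpose_mat N = 0\<^sub>m p r"
    and N': "N' \<in> carrier_mat t (p + r)" and KN': "K * transpose_mat N' = 0\<^sub>m p t"
  shows "\<exists>A\<in>carrier_mat t r. N' = A * N"
proof -
  from minimal_rows_right_inverse[OF minK K] obtain X where
    X: "X \<in> carrier_mat (p + r) p" "K * X = 1\<^sub>m p" by blast
  from minimal_rows_right_inverse[OF minN N] obtain Y where
    Y: "Y \<in> carrier_mat (p + r) r" "N * Y = 1\<^sub>m r" by blast
  let ?W = "four_block_mat K (0\<^sub>m p 0) (transpose_mat Y) (0\<^sub>m r 0)"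
  define T where "T = transpose_mat Y * transpose_mat N'"
  have T: "T \<in> carrier_mat r t" using Y N' by (simp add: T_def)
  have W: "?W \<in> carrier_mat (p + r) (p + r)"
    using four_block_carrier_mat[OF K, of "0\<^sub>m r 0" r 0] by simp
  have WA: "?W * A = four_block_mat (K * A) (0\<^sub>m p 0) (transpose_mat Y * A) (0\<^sub>m r 0)"
    if A: "A \<in> carrier_mat (p + r) t" for A
  proof -
    have "A = four_block_mat A (0\<^sub>m (p + r) 0) (0\<^sub>m 0 t) (0\<^sub>m 0 0)"
      using A by (intro eq_matI) auto
    then have "?W * A = ?W * four_block_mat A (0\<^sub>m (p + r) 0) (0\<^sub>m 0 t) (0\<^sub>m 0 0)" by simp
    also have "\<dots> = four_block_mat (K * A) (0\<^sub>m p 0) (transpose_mat Y * A) (0\<^sub>m r 0)"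
      using K Y A by (subst mult_four_block_mat[of _ p "p + r" _ 0 _ r _ _ t _ 0]) auto
    finally show ?thesis .
  qed
  have NT: "transpose_mat N * T \<in> carrier_mat (p + r) t" using N T by simp
  have "K * (transpose_mat N * T) = 0\<^sub>m p t"
    using K N T KN assoc_mult_mat[of K p "p + r" "transpose_mat N" r T t] by simp
  moreover have "transpose_mat Y * (transpose_mat N * T) = T"
  proof -
    have "transpose_mat Y * transpose_mat N = 1\<^sub>m r"
      using transpose_mult[OF N Y(1)] Y(2) by simp
    then show ?thesis
      using Y N T assoc_mult_mat[of "transpose_mat Y" r "p + r" "transpose_mat N" r T t] by simp
  qed
  ultimately have "?W * transpose_mat N' = ?W * (transpose_mat N * T)"
    using WA[OF NT] WA[of "transpose_mat N'"] N' KN' by (simp add: T_def)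
  moreover have "det ?W \<noteq> 0"
    using unimodular_dual_completion(2)[OF K N X(1) Y(1) X(2) Y(2) KN]
    by (auto simp: unimodular_def)
  ultimately have "transpose_mat N' = transpose_mat N * T"
    using mult_left_cancel_mat[OF W _ _ NT, of "transpose_mat N'"] N' by simp
  then have "N' = transpose_mat (transpose_mat N * T)" by (metis transpose_transpose)
  also have "\<dots> = transpose_mat T * N" using transpose_mult[of "transpose_mat N" "p + r" r T t] N T by simp
  finally show ?thesis using T by (intro bexI[of _ "transpose_mat T"]) auto
qed

text \<open>Write \<open>N' = A * N\<close> and \<open>N = B * N'\<close>, so that \<open>A\<close> and \<open>B\<close> are inverse to each other, and pick \<open>k\<close> with
  \<open>A\<^sub>i\<^sub>k\<close> and \<open>B\<^sub>k\<^sub>i\<close> both nonzero. The exchange property of \<open>N\<close> bounds the degree of row \<open>i\<close> of \<open>N'\<close>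
  from below by \<open>e\<close>, and that of \<open>N'\<close> bounds the degree of row \<open>k\<close> of \<open>N\<close> from below by \<open>d i\<close>.\<close>
lemma minimal_rows_uniform_degree:
  fixes K N N' :: "'a::field poly mat"
  assumes K: "K \<in> carrier_mat p (p + r)" and minK: "minimal_rows k K"
    and N: "N \<in> carrier_mat r (p + r)" and minN: "minimal_rows (\<lambda>_. e) N"
    and KN: "K * transpose_mat N = 0\<^sub>m p r"
    and N': "N' \<in> carrier_mat r (p + r)" and minN': "minimal_rows d N'"
    and KN': "K * transpose_mat N' = 0\<^sub>m p r"
    and i: "i < r"
  shows "d i = e"
proof -
  obtain A where A: "A \<in> carrier_mat r r" "N' = A * N"
    using minimal_rows_change_basis[OF K minK N minN KN N' KN'] by blast
  obtain B where B: "B \<in> carrier_mat r r" "N = B * N'"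
    using minimal_rows_change_basis[OF K minK N' minN' KN' N KN] by blast
  from minimal_rows_right_inverse[OF minN' N'] obtain Y where
    Y: "Y \<in> carrier_mat (p + r) r" "N' * Y = 1\<^sub>m r" by blast
  have AB: "A * B = 1\<^sub>m r"
  proof -
    have "(A * B) * N' = A * (B * N')" by (rule assoc_mult_mat[OF A(1) B(1) N'])
    then have "(A * B) * N' = N'" by (simp only: A(2)[symmetric] B(2)[symmetric])
    then have "(A * B) * (N' * Y) = N' * Y"
      using assoc_mult_mat[of "A * B" r r N' "p + r" Y r] A(1) B(1) N' Y(1) by simp
    then show ?thesis unfolding Y(2) using A(1) B(1) by simp
  qed
  have row_combination: "transpose_mat S *\<^sub>v row C j = 1 \<cdot>\<^sub>v row (C * S) j"
    if "C \<in> carrier_mat r r" "S \<in> carrier_mat r (p + r)" "j < r" for C S :: "'a poly mat" and j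
    using that by (intro eq_vecI) (auto simp: scalar_prod_def mult.commute intro!: sum.cong)
  have "(A * B) $$ (i, i) \<noteq> 0" unfolding AB using i by simp
  then have "(\<Sum>k<r. A $$ (i, k) * B $$ (k, i)) \<noteq> 0"
    using A(1) B(1) i by (simp add: scalar_prod_def atLeast0LessThan)
  then obtain k where k: "k < r" "A $$ (i, k) \<noteq> 0" "B $$ (k, i) \<noteq> 0"
    by (auto elim!: sum.not_neutral_contains_not_neutral)
  have "e \<le> d i"
  proof -
    have "row A i $ k \<noteq> 0" using k A(1) i by simp
    from minimal_rowsE[OF minN N _ _ _ row_combination[OF A(1) N i] k(1) this]
    obtain j where "j < p + r" "e \<le> degree (row (A * N) i $ j)" using A(1) N i by auto
    then show ?thesis
      using minimal_rows_degree_le[OF minN', of i j] N' i unfolding A(2)[symmetric] by auto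
  qed
  moreover have "d i \<le> e"
  proof -
    have "row B k $ i \<noteq> 0" using k B(1) i by simp
    from minimal_rowsE[OF minN' N' _ _ _ row_combination[OF B(1) N' k(1)] i this]
    obtain j where "j < p + r" "d i \<le> degree (row (B * N') k $ j)" using B(1) N' k by auto
    then show ?thesis
      using minimal_rows_degree_le[OF minN, of k j] N k unfolding B(2)[symmetric] by auto
  qed
  ultimately show ?thesis by simp
qed

text \<open>The assumption on a strong block minimal bases matrix provides some dual basis with equal row
  degrees; this carries the property over to the given one.\<close>
lemma dual_minimal_basis_uniform:
  fixes K N N' :: "'a::field poly mat"
  assumes dual: "dual_minimal_bases K N" and dual': "dual_minimal_bases K N'"
    and uniform: "\<forall>e'\<in>set (row_degrees N'). e' = e"
  shows "minimal_rows (\<lambda>_. e) N"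
proof -
  define p r where "p = dim_row K" and "r = dim_row N"
  have c: "K \<in> carrier_mat p (p + r)" "N \<in> carrier_mat r (p + r)" "N' \<in> carrier_mat r (p + r)"
    "K * transpose_mat N = 0\<^sub>m p r" "K * transpose_mat N' = 0\<^sub>m p r"
    using dual dual' by (auto simp: dual_minimal_bases_def p_def r_def)
  have min: "minimal_rows (\<lambda>i. vec_degree (row K i)) K" "minimal_rows (\<lambda>i. vec_degree (row N i)) N"
    "minimal_rows (\<lambda>i. vec_degree (row N' i)) N'"
    using dual dual' by (auto simp: dual_minimal_bases_def intro: minimal_basis_minimal_rows)
  have "vec_degree (row N' i) = e" if "i < r" for i
    using uniform that c(3) by (auto simp: row_degrees_def rows_def)
  then have min': "minimal_rows (\<lambda>_. e) N'"
    using min(3) c(3) by (subst minimal_rows_cong[of _ _ "\<lambda>i. vec_degree (row N' i)"]) auto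
  have "vec_degree (row N i) = e" if "i < r" for i
    using minimal_rows_uniform_degree[OF c(1) min(1) c(3) min' c(5) c(2) min(2) c(4) that] .
  then show ?thesis
    using min(2) c(2) by (subst minimal_rows_cong[of _ _ "\<lambda>i. vec_degree (row N i)"]) auto
qed

text \<open>A block without rows satisfies the exchange property vacuously and is paired with the identity. So
  absent and present blocks can be treated alike from here on.\<close>
lemma dual_pair_minimal_rows:
  fixes K N :: "'a::field poly mat"
  assumes K: "K \<in> carrier_mat p (r + p)" and N: "N \<in> carrier_mat r (r + p)"
    and dual: "p \<noteq> 0 \<Longrightarrow> dual_minimal_bases K N" and absent: "p = 0 \<Longrightarrow> N = 1\<^sub>m r"
  shows "\<exists>d. minimal_rows d K" "\<exists>e. minimal_rows e N" "K * transpose_mat N = 0\<^sub>m p r"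
proof -
  have empty: "minimal_rows d K" if "p = 0" for d
    using that K by (simp add: minimal_rows_def)
  show "\<exists>d. minimal_rows d K" "\<exists>e. minimal_rows e N"
    using empty minimal_rows_one absent dual minimal_basis_minimal_rows
    unfolding dual_minimal_bases_def by (cases "p = 0"; blast)+
  show "K * transpose_mat N = 0\<^sub>m p r"
  proof (cases "p = 0")
    case True
    then show ?thesis using K N by (intro eq_matI) auto
  next
    case False
    from dual[OF this] show ?thesis using K N by (simp add: dual_minimal_bases_def)
  qed
qed

text \<open>The constant bound for \<open>N\<close> is its degree as a matrix, because that is the grade with respect to which
  \<open>N\<close> is reversed when \<open>Q\<close> is.\<close>
lemma strong_dual_pair_minimal_rows:
  fixes K N :: "'a::field poly mat"
  assumes K: "K \<in> carrier_mat p (r + p)" and N: "N \<in> carrier_mat r (r + p)"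
    and dual: "p \<noteq> 0 \<Longrightarrow> dual_minimal_bases K N" and absent: "p = 0 \<Longrightarrow> N = 1\<^sub>m r"
    and strong: "dim_row K \<noteq> 0 \<longrightarrow> (\<forall>e\<in>set (row_degrees K). e = l) \<and>
      (\<exists>N e. dual_minimal_bases K N \<and> (\<forall>e'\<in>set (row_degrees N). e' = e))"
  shows "minimal_rows (\<lambda>_. l) K" "minimal_rows (\<lambda>_. mat_degree N) N"
proof -
  show "minimal_rows (\<lambda>_. l) K"
  proof (cases "p = 0")
    case True
    then show ?thesis using K by (simp add: minimal_rows_def)
  next
    case False
    then have "vec_degree (row K i) = l" if "i < p" for i
      using strong that K by (auto simp: row_degrees_def rows_def)
    moreover have "minimal_rows (\<lambda>i. vec_degree (row K i)) K"
      using dual[OF False] by (auto simp: dual_minimal_bases_def intro: minimal_basis_minimal_rows)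
    ultimately show ?thesis
      using K by (subst minimal_rows_cong[of _ _ "\<lambda>i. vec_degree (row K i)"]) auto
  qed
  have "\<exists>e. minimal_rows (\<lambda>_. e) N"
  proof (cases "p = 0")
    case True
    then show ?thesis using absent minimal_rows_one by auto
  next
    case False
    then obtain N' e where "dual_minimal_bases K N'" "\<forall>e'\<in>set (row_degrees N'). e' = e"
      using strong K by auto
    from dual_minimal_basis_uniform[OF dual[OF False] this] show ?thesis by blast
  qed
  then obtain e where e: "minimal_rows (\<lambda>_. e) N" by blast
  show "minimal_rows (\<lambda>_. mat_degree N) N"
  proof (cases "dim_row N = 0")
    case True
    then show ?thesis by (simp add: minimal_rows_def)
  next
    case False
    from minimal_rows_mat_degree[OF e this] e show ?thesis by simp
  qed
qed

section \<open>Reversals\<close>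

lemma coeff_poly_rev: "coeff (poly_rev d p) k = (if k \<le> d then coeff p (d - k) else 0)"
proof -
  have "coeff (poly_rev d p) k = (\<Sum>i\<le>d. if d - i = k then coeff p i else 0)"
    by (simp add: poly_rev_def coeff_sum)
  also have "\<dots> = (\<Sum>i\<le>d. if i = d - k \<and> k \<le> d then coeff p i else 0)"
    by (intro sum.cong) auto
  also have "\<dots> = (if k \<le> d then coeff p (d - k) else 0)"
    by (auto simp: sum.delta')
  finally show ?thesis .
qed

lemma degree_poly_rev_le: "degree (poly_rev d p) \<le> d"
  by (rule degree_le) (simp add: coeff_poly_rev)

lemma poly_rev_poly_rev: "degree p \<le> d \<Longrightarrow> poly_rev d (poly_rev d p) = p"
  by (rule poly_eqI) (auto simp: coeff_poly_rev coeff_eq_0)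

lemma poly_rev_0 [simp]: "poly_rev d 0 = 0"
  by (rule poly_eqI) (simp add: coeff_poly_rev)

lemma poly_rev_eq_0_iff: "degree p \<le> d \<Longrightarrow> poly_rev d p = 0 \<longleftrightarrow> p = 0"
  by (metis poly_rev_poly_rev poly_rev_0)

lemma poly_rev_sum: "poly_rev d (\<Sum>i\<in>A. f i) = (\<Sum>i\<in>A. poly_rev d (f i))"
  by (rule poly_eqI) (simp add: coeff_poly_rev coeff_sum)

text \<open>This reduces multiplicativity of the reversal to that of the reflected polynomial.\<close>
lemma poly_rev_conv_reflect_poly:
  fixes p :: "'a::field poly"
  assumes "degree p \<le> d"
  shows "poly_rev d p = monom 1 (d - degree p) * reflect_poly p"
  using assms by (intro poly_eqI) (auto simp: coeff_poly_rev coeff_monom_mult coeff_reflect_poly coeff_eq_0)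

lemma poly_rev_mult:
  fixes p q :: "'a::field poly"
  assumes "degree p \<le> a" "degree q \<le> b"
  shows "poly_rev (a + b) (p * q) = poly_rev a p * poly_rev b q"
proof (cases "p = 0 \<or> q = 0")
  case False
  have "degree (p * q) \<le> a + b" using degree_mult_le[of p q] assms by linarith
  moreover have "monom 1 (a + b - degree (p * q))
      = monom (1::'a) (a - degree p) * monom 1 (b - degree q)"
    using False assms by (simp add: degree_mult_eq mult_monom)
  ultimately show ?thesis
    using assms by (simp add: poly_rev_conv_reflect_poly reflect_poly_mult ac_simps)
qed auto

lemma index_mat_rev [simp]:
  "i < dim_row A \<Longrightarrow> j < dim_col A \<Longrightarrow> mat_rev d A $$ (i, j) = poly_rev d (A $$ (i, j))"
  "dim_row (mat_rev d A) = dim_row A" "dim_col (mat_rev d A) = dim_col A"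
  by (simp_all add: mat_rev_def)

lemma mat_rev_carrier [simp]: "mat_rev d A \<in> carrier_mat p q \<longleftrightarrow> A \<in> carrier_mat p q"
  by (simp add: mat_rev_def)

lemma mat_rev_transpose: "mat_rev d (transpose_mat A) = transpose_mat (mat_rev d A)"
  by (intro eq_matI) auto

lemma mat_rev_0 [simp]: "mat_rev d (0\<^sub>m p q) = 0\<^sub>m p q"
  by (intro eq_matI) auto

lemma mat_degree_mat_rev_le: "mat_degree (mat_rev d A) \<le> d"
  by (simp add: mat_degree_le_iff degree_poly_rev_le)

lemma mat_degree_transpose: "mat_degree (transpose_mat A) \<le> d \<longleftrightarrow> mat_degree A \<le> d"
  by (auto simp: mat_degree_le_iff)

lemma mat_degree_mult_le:
  fixes A B :: "'a::field poly mat"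
  assumes "A \<in> carrier_mat p r" "B \<in> carrier_mat r q" "mat_degree A \<le> a" "mat_degree B \<le> b"
  shows "mat_degree (A * B) \<le> a + b"
proof -
  have "degree ((A * B) $$ (i, j)) \<le> a + b" if ij: "i < p" "j < q" for i j
  proof -
    have "degree (A $$ (i, k) * B $$ (k, j)) \<le> a + b" if "k < r" for k
    proof (rule order_trans[OF degree_mult_le add_mono])
      show "degree (A $$ (i, k)) \<le> a" "degree (B $$ (k, j)) \<le> b"
        using assms that ij by (auto simp: mat_degree_le_iff)
    qed
    then show ?thesis using ij assms(1,2) by (auto simp: scalar_prod_def intro!: degree_sum_le)
  qed
  then show ?thesis using assms(1,2) by (simp add: mat_degree_le_iff)
qed

lemma mat_rev_mult:
  fixes A B :: "'a::field poly mat"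
  assumes "A \<in> carrier_mat p r" "B \<in> carrier_mat r q" "mat_degree A \<le> a" "mat_degree B \<le> b"
  shows "mat_rev (a + b) (A * B) = mat_rev a A * mat_rev b B"
proof (rule eq_matI)
  fix i j assume "i < dim_row (mat_rev a A * mat_rev b B)" "j < dim_col (mat_rev a A * mat_rev b B)"
  then have ij: "i < p" "j < q" using assms(1,2) by auto
  have "poly_rev (a + b) (A $$ (i, k) * B $$ (k, j)) = poly_rev a (A $$ (i, k)) * poly_rev b (B $$ (k, j))"
    if "k < r" for k
    using assms that ij unfolding mat_degree_le_iff by (intro poly_rev_mult) auto
  then show "mat_rev (a + b) (A * B) $$ (i, j) = (mat_rev a A * mat_rev b B) $$ (i, j)"
    using ij assms(1,2) by (auto simp: scalar_prod_def poly_rev_sum intro!: sum.cong)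
qed (use assms in auto)

lemma mat_rev_block_mat: "mat_rev d (block_mat M K1 K2) = block_mat (mat_rev d M) (mat_rev d K1) (mat_rev d K2)"
  if "M \<in> carrier_mat (dim_col K2) (dim_col K1)"
  using that by (intro eq_matI) (auto simp: block_mat_def)

text \<open>Suppose \<open>g w\<close> is the combination \<open>a\<close> of the rows of the reversed matrix and all entries of \<open>w\<close> have
  degree less than \<open>d\<close>. Reversing the identity with respect to the grade \<open>\<rho> + d\<close>, where \<open>\<rho>\<close> bounds
  the degrees of \<open>g\<close> and \<open>a\<close>, gives such a combination of the rows of \<open>K\<close>, with \<open>w\<close> reversed with
  respect to \<open>d - 1\<close>. Its entries still have degree less than \<open>d\<close>, against the exchange property of
  \<open>K\<close>.\<close>
lemma minimal_rows_rev:
  fixes K :: "'a::field poly mat"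
  assumes min: "minimal_rows (\<lambda>_. d) K"
  shows "minimal_rows (\<lambda>_. d) (mat_rev d K)"
proof -
  define p q where "p = dim_row K" and "q = dim_col K"
  have K: "K \<in> carrier_mat p q" and dK: "dim_row K = p" "dim_col K = q" by (simp_all add: p_def q_def)
  have deg: "degree (K $$ (i, j)) \<le> d" if "i < p" "j < q" for i j
    using minimal_rows_degree_le[OF min] that K by auto
  have "\<exists>j<q. w $ j \<noteq> 0 \<and> d \<le> degree (w $ j)"
    if g: "g \<noteq> 0" and a: "a \<in> carrier_vec p" and w: "w \<in> carrier_vec q"
      and eq: "transpose_mat (mat_rev d K) *\<^sub>v a = g \<cdot>\<^sub>v w" and i: "i < p" and ai: "a $ i \<noteq> 0"
    for g a w i
  proof (rule ccontr)
    assume "\<not> ?thesis"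
    then have small: "w $ j = 0 \<or> degree (w $ j) < d" if "j < q" for j
      using that by auto
    obtain \<rho> where \<rho>: "degree g \<le> \<rho>" "\<And>k. k < p \<Longrightarrow> degree (a $ k) \<le> \<rho>"
    proof
      show "degree g \<le> degree g + (\<Sum>k<p. degree (a $ k))" by simp
      show "degree (a $ k) \<le> degree g + (\<Sum>k<p. degree (a $ k))" if "k < p" for k
        using member_le_sum[of k "{..<p}" "\<lambda>k. degree (a $ k)"] that by simp
    qed
    \<comment> \<open>The grades satisfy \<open>\<rho> + d = Suc \<rho> + (d - 1)\<close> if \<open>0 < d\<close>; for \<open>d = 0\<close> the vector \<open>w\<close> is zero and
      the truncated difference does no harm.\<close>
    define a' where "a' = vec p (\<lambda>k. poly_rev \<rho> (a $ k))"
    define w' where "w' = vec q (\<lambda>j. poly_rev (d - 1) (w $ j))"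
    define g' where "g' = poly_rev (Suc \<rho>) g"
    have a': "a' \<in> carrier_vec p" and w': "w' \<in> carrier_vec q" by (simp_all add: a'_def w'_def)
    have g': "g' \<noteq> 0" using g \<rho>(1) by (simp add: g'_def poly_rev_eq_0_iff)
    have a'i: "a' $ i \<noteq> 0" using ai i \<rho>(2) by (simp add: a'_def poly_rev_eq_0_iff)
    have "transpose_mat K *\<^sub>v a' = g' \<cdot>\<^sub>v w'"
    proof (rule eq_vecI)
      fix j assume "j < dim_vec (g' \<cdot>\<^sub>v w')"
      then have j: "j < q" by (simp add: w'_def)
      have "(transpose_mat K *\<^sub>v a') $ j = (\<Sum>k<p. poly_rev d (mat_rev d K $$ (k, j)) * poly_rev \<rho> (a $ k))"
        unfolding index_transpose_mult_vec[OF K a' j]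
        using j deg K by (intro sum.cong) (auto simp: a'_def poly_rev_poly_rev)
      also have "\<dots> = poly_rev (d + \<rho>) (\<Sum>k<p. mat_rev d K $$ (k, j) * a $ k)"
        unfolding poly_rev_sum using j \<rho>(2) K
        by (intro sum.cong poly_rev_mult[symmetric]) (auto simp: degree_poly_rev_le)
      also have "(\<Sum>k<p. mat_rev d K $$ (k, j) * a $ k) = g * w $ j"
        using index_transpose_mult_vec[of "mat_rev d K" p q a j] K a j w unfolding eq by simp
      also have "poly_rev (d + \<rho>) (g * w $ j) = g' * poly_rev (d - 1) (w $ j)"
      proof (cases "w $ j = 0")
        case False
        with small[OF j] have "degree (w $ j) \<le> d - 1" "d + \<rho> = Suc \<rho> + (d - 1)" by auto
        then show ?thesis
          unfolding g'_def using \<rho>(1) by (simp only: poly_rev_mult le_SucI)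
      qed simp
      finally show "(transpose_mat K *\<^sub>v a') $ j = (g' \<cdot>\<^sub>v w') $ j"
        using j by (simp add: w'_def)
    qed (use K in \<open>simp add: w'_def\<close>)
    from minimal_rowsE[OF min K g' a' w' this i a'i]
    obtain j where j: "j < q" "w' $ j \<noteq> 0" "d \<le> degree (w' $ j)" .
    then have "w $ j \<noteq> 0" by (auto simp: w'_def)
    with small[OF j(1)] have "0 < d" by auto
    moreover have "degree (w' $ j) \<le> d - 1" using j(1) by (simp add: w'_def degree_poly_rev_le)
    ultimately show False using j(3) by simp
  qed
  then show ?thesis unfolding minimal_rows_def index_mat_rev(2,3) dK
    using K by (auto simp: degree_poly_rev_le)
qed

section \<open>Unimodular equivalence of the block matrix\<close>

text \<open>The equivalence behind \<open>lification\<close>, separated from the degree conditions so that it can be composed,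
  transposed and extended by an identity block.\<close>
definition unimodularly_equivalent :: "'a::field poly mat \<Rightarrow> 'a poly mat \<Rightarrow> bool" where
  "unimodularly_equivalent A B \<longleftrightarrow>
    (\<exists>U V. U \<in> carrier_mat (dim_row A) (dim_row A) \<and> unimodular U \<and>
           V \<in> carrier_mat (dim_col A) (dim_col A) \<and> unimodular V \<and> U * A * V = B)"

lemma unimodularly_equivalentI:
  assumes "A \<in> carrier_mat p q" "U \<in> carrier_mat p p" "unimodular U"
    "V \<in> carrier_mat q q" "unimodular V" "U * A * V = B"
  shows "unimodularly_equivalent A B"
  unfolding unimodularly_equivalent_def carrier_matD[OF assms(1)] using assms(2-) by blast

lemma unimodularly_equivalentE:
  assumes "unimodularly_equivalent A B" "A \<in> carrier_mat p q"
  obtains U V where "U \<in> carrier_mat p p" "unimodular U" "V \<in> carrier_mat q q" "unimodular V"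
    "U * A * V = B"
  using assms by (auto simp: unimodularly_equivalent_def)

lemma unimodularly_equivalent_trans [trans]:
  assumes "unimodularly_equivalent A B" "unimodularly_equivalent B C"
  shows "unimodularly_equivalent A C"
proof -
  define p q where "p = dim_row A" and "q = dim_col A"
  have A: "A \<in> carrier_mat p q" by (simp add: p_def q_def)
  from unimodularly_equivalentE[OF assms(1) A] obtain U V where
    1: "U \<in> carrier_mat p p" "unimodular U" "V \<in> carrier_mat q q" "unimodular V" "U * A * V = B" .
  have B: "B \<in> carrier_mat p q" using 1 A by auto
  from unimodularly_equivalentE[OF assms(2) B] obtain U' V' where
    2: "U' \<in> carrier_mat p p" "unimodular U'" "V' \<in> carrier_mat q q" "unimodular V'" "U' * B * V' = C" .
  have "(U' * U) * A * (V * V') = U' * (U * A * V) * V'"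
  proof -
    have "(U' * U) * A * (V * V') = U' * (U * A) * (V * V')"
      using 1(1) 2(1) A by (simp only: assoc_mult_mat[of U' p p U p A q])
    also have "\<dots> = U' * (U * A) * V * V'"
      using 1(1,3) 2(1,3) A by (intro assoc_mult_mat[of _ p q, symmetric]) auto
    also have "U' * (U * A) * V = U' * (U * A * V)"
      using 1(1,3) 2(1) A by (intro assoc_mult_mat[of _ p p]) auto
    finally show ?thesis .
  qed
  then have "(U' * U) * A * (V * V') = C" unfolding 1(5) 2(5) .
  with A 1 2 show ?thesis
    by (intro unimodularly_equivalentI[of A p q "U' * U" "V * V'"]) (auto intro: unimodular_mult)
qed

lemma unimodularly_equivalent_transpose:
  assumes "unimodularly_equivalent A B"
  shows "unimodularly_equivalent (transpose_mat A) (transpose_mat B)"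
proof -
  define p q where "p = dim_row A" and "q = dim_col A"
  have A: "A \<in> carrier_mat p q" by (simp add: p_def q_def)
  from unimodularly_equivalentE[OF assms A] obtain U V where
    1: "U \<in> carrier_mat p p" "unimodular U" "V \<in> carrier_mat q q" "unimodular V" "U * A * V = B" .
  have "transpose_mat B = transpose_mat V * (transpose_mat A * transpose_mat U)"
    unfolding 1(5)[symmetric] using 1(1,3) A
    by (simp add: transpose_mult[of _ p q _ q] transpose_mult[of _ p p _ q])
  also have "\<dots> = transpose_mat V * transpose_mat A * transpose_mat U"
    using 1(1,3) A by (simp add: assoc_mult_mat[of _ q q _ p _ p])
  finally show ?thesis using 1 A
    by (intro unimodularly_equivalentI[of _ q p "transpose_mat V" "transpose_mat U"])
      (auto intro: unimodular_transpose)
qed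

abbreviation block_diag :: "nat \<Rightarrow> 'a::field poly mat \<Rightarrow> 'a poly mat" where
  "block_diag s A \<equiv> four_block_mat (1\<^sub>m s) (0\<^sub>m s (dim_col A)) (0\<^sub>m (dim_row A) s) A"

lemma unimodularly_equivalent_block_diag:
  assumes "unimodularly_equivalent A B"
  shows "unimodularly_equivalent (block_diag s A) (block_diag s B)"
proof -
  define p q where "p = dim_row A" and "q = dim_col A"
  have A: "A \<in> carrier_mat p q" by (simp add: p_def q_def)
  from unimodularly_equivalentE[OF assms A] obtain U V where
    1: "U \<in> carrier_mat p p" "unimodular U" "V \<in> carrier_mat q q" "unimodular V" "U * A * V = B" .
  have B: "B \<in> carrier_mat p q" using 1 A by auto
  let ?U = "four_block_mat (1\<^sub>m s) (0\<^sub>m s p) (0\<^sub>m p s) U"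
  let ?V = "four_block_mat (1\<^sub>m s) (0\<^sub>m s q) (0\<^sub>m q s) V"
  let ?A = "four_block_mat (1\<^sub>m s) (0\<^sub>m s q) (0\<^sub>m p s) A"
  have "?U * ?A = four_block_mat (1\<^sub>m s) (0\<^sub>m s q) (0\<^sub>m p s) (U * A)"
    using 1 A by (subst mult_four_block_mat[of _ s s _ p _ p _ _ s _ q]) auto
  also have "\<dots> * ?V = four_block_mat (1\<^sub>m s) (0\<^sub>m s q) (0\<^sub>m p s) (U * A * V)"
    using 1 A by (subst mult_four_block_mat[of _ s s _ q _ p _ _ s _ q]) auto
  finally have "?U * ?A * ?V = four_block_mat (1\<^sub>m s) (0\<^sub>m s q) (0\<^sub>m p s) B" unfolding 1(5) .
  then show ?thesis using A B 1
    by (intro unimodularly_equivalentI[of _ "s + p" "s + q" ?U ?V])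
      (auto intro: unimodular_block_diag)
qed

lemma block_diag_block_diag: "block_diag s (block_diag t A) = block_diag (s + t) A"
proof -
  have "block_diag s (block_diag t A) = four_block_mat (block_diag s (1\<^sub>m t))
      (0\<^sub>m (s + t) (dim_col A)) (0\<^sub>m (dim_row A) (s + t)) A"
    using assoc_four_block_mat[of "1\<^sub>m s :: 'a poly mat" "1\<^sub>m t" A] by simp
  then show ?thesis by simp
qed

text \<open>Right multiplication by the unimodular matrix formed by \<open>X\<close> and \<open>N\<^sup>T\<close> turns the stack of \<open>R\<close> and
  \<open>K\<close> into the block matrix with rows \<open>(R * X, R * N\<^sup>T)\<close> and \<open>(1, 0)\<close>; swapping the block rows and
  subtracting \<open>R * X\<close> times the identity row from the other one clears the remaining block.\<close>
lemma stacked_equivalence: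
  fixes K N X Y R :: "'a::field poly mat"
  assumes K: "K \<in> carrier_mat p (p + r)" and N: "N \<in> carrier_mat r (p + r)"
    and X: "X \<in> carrier_mat (p + r) p" and Y: "Y \<in> carrier_mat (p + r) r"
    and KX: "K * X = 1\<^sub>m p" and NY: "N * Y = 1\<^sub>m r"
    and KN: "K * transpose_mat N = 0\<^sub>m p r"
    and R: "R \<in> carrier_mat t (p + r)"
  shows "unimodularly_equivalent (four_block_mat R (0\<^sub>m t 0) K (0\<^sub>m p 0))
    (block_diag p (R * transpose_mat N))"
proof -
  define S where "S = R * X"
  let ?V = "four_block_mat X (transpose_mat N) (0\<^sub>m 0 p) (0\<^sub>m 0 r)"
  let ?U = "four_block_mat (0\<^sub>m p t) (1\<^sub>m p) (1\<^sub>m t) (- S)"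
  let ?W = "four_block_mat S (1\<^sub>m t) (1\<^sub>m p) (0\<^sub>m p t)"
  let ?A = "four_block_mat R (0\<^sub>m t 0) K (0\<^sub>m p 0)"
  have RX: "S \<in> carrier_mat t p" using R X by (simp add: S_def)
  have RN: "R * transpose_mat N \<in> carrier_mat t r" using R N by simp
  have V: "?V \<in> carrier_mat (p + r) (p + r)"
    using four_block_carrier_mat[OF X, of "0\<^sub>m 0 r" 0 r] by simp
  have A: "?A \<in> carrier_mat (t + p) (p + r)"
    using four_block_carrier_mat[OF R, of "0\<^sub>m p 0" p 0] by simp
  have U: "?U \<in> carrier_mat (t + p) (t + p)"
    by (rule carrier_matI) (use RX in simp_all)
  have W: "?W \<in> carrier_mat (t + p) (t + p)"
    by (rule carrier_matI) (use RX in simp_all)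
  \<comment> \<open>The inverse \<open>?W\<close> of the row operation \<open>?U\<close> shows that it is unimodular.\<close>
  have "S + - S = 0\<^sub>m t p" using RX by (intro eq_matI) auto
  then have "?U * ?W = four_block_mat (1\<^sub>m p) (0\<^sub>m p t) (0\<^sub>m t p) (1\<^sub>m t)"
    using RX by (subst mult_four_block_mat[of _ p t _ p _ t _ _ p _ t]) auto
  then have "is_unit (det (?U * ?W))" by simp
  from unimodular_of_mult(1)[OF U W this] have uU: "unimodular ?U" .
  have "?U * ?A = four_block_mat K (0\<^sub>m p 0) (R - S * K) (0\<^sub>m t 0)"
    using RX K R by (subst mult_four_block_mat[of _ p t _ p _ t _ _ "p + r" _ 0])
      (auto simp: minus_add_uminus_mat[of _ t "p + r"])
  also have "\<dots> * ?V = four_block_mat (K * X) (K * transpose_mat N)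
      ((R - S * K) * X) ((R - S * K) * transpose_mat N)"
    using RX K R X N by (subst mult_four_block_mat[of _ p "p + r" _ 0 _ t _ _ p _ r])
      (auto simp: minus_carrier_mat)
  also have "(R - S * K) * X = 0\<^sub>m t p"
  proof -
    have "(R - S * K) * X = S - S * (K * X)"
      using R X K RX by (simp add: S_def[symmetric] minus_mult_distrib_mat[of _ t "p + r"] assoc_mult_mat[of _ t p K _ X])
    then show ?thesis unfolding KX using RX by simp
  qed
  also have "(R - S * K) * transpose_mat N = R * transpose_mat N"
  proof -
    have "(R - S * K) * transpose_mat N = R * transpose_mat N - S * (K * transpose_mat N)"
      using R X K N RX
      by (simp add: minus_mult_distrib_mat[of _ t "p + r"] assoc_mult_mat[of _ t p K _ "transpose_mat N"])
    moreover have "B - 0\<^sub>m t r = B" if "B \<in> carrier_mat t r" for B :: "'a poly mat"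
      using that by (intro eq_matI) auto
    ultimately show ?thesis unfolding KN using RX RN by simp
  qed
  finally have "?U * ?A * ?V = block_diag p (R * transpose_mat N)"
    using R N unfolding KX KN by simp
  then show ?thesis
    using unimodularly_equivalentI[OF A U uU V unimodular_dual_completion(1)[OF K N X Y KX NY KN]]
    by simp
qed

text \<open>The block matrix is the stack of \<open>(M, K\<^sub>2\<^sup>T)\<close> and \<open>(K\<^sub>1, 0)\<close>. The latter is dual to the block diagonal
  matrix with blocks \<open>N\<^sub>1\<close> and \<open>1\<close>, so one elimination leaves \<open>(M * N\<^sub>1\<^sup>T, K\<^sub>2\<^sup>T)\<close>. Its transpose is
  again a stack, now over \<open>K\<^sub>2\<close>, and a second elimination leaves \<open>N\<^sub>2 * M * N\<^sub>1\<^sup>T\<close>.\<close>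
lemma block_mat_equivalence:
  fixes K1 N1 K2 N2 M :: "'a::field poly mat"
  assumes K1: "K1 \<in> carrier_mat m1 (n + m1)" and N1: "N1 \<in> carrier_mat n (n + m1)"
    and K2: "K2 \<in> carrier_mat m2 (m + m2)" and N2: "N2 \<in> carrier_mat m (m + m2)"
    and M: "M \<in> carrier_mat (m + m2) (n + m1)"
    and X1: "X1 \<in> carrier_mat (n + m1) m1" "K1 * X1 = 1\<^sub>m m1"
    and Y1: "Y1 \<in> carrier_mat (n + m1) n" "N1 * Y1 = 1\<^sub>m n"
    and X2: "X2 \<in> carrier_mat (m + m2) m2" "K2 * X2 = 1\<^sub>m m2"
    and Y2: "Y2 \<in> carrier_mat (m + m2) m" "N2 * Y2 = 1\<^sub>m m"
    and KN1: "K1 * transpose_mat N1 = 0\<^sub>m m1 n" and KN2: "K2 * transpose_mat N2 = 0\<^sub>m m2 m"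
  shows "unimodularly_equivalent (block_mat M K1 K2)
    (block_diag (m1 + m2) (N2 * M * transpose_mat N1))"
proof -
  let ?K = "four_block_mat K1 (0\<^sub>m m1 m2) (0\<^sub>m 0 (n + m1)) (0\<^sub>m 0 m2)"
  let ?X = "four_block_mat X1 (0\<^sub>m (n + m1) 0) (0\<^sub>m m2 m1) (0\<^sub>m m2 0)"
  let ?N = "four_block_mat N1 (0\<^sub>m n m2) (0\<^sub>m m2 (n + m1)) (1\<^sub>m m2)"
  let ?Y = "four_block_mat Y1 (0\<^sub>m (n + m1) m2) (0\<^sub>m m2 n) (1\<^sub>m m2)"
  let ?R = "four_block_mat M (transpose_mat K2) (0\<^sub>m 0 (n + m1)) (0\<^sub>m 0 m2)"
  let ?MN = "M * transpose_mat N1"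
  have MN: "?MN \<in> carrier_mat (m + m2) n" using M N1 by simp
  have eq: "block_mat M K1 K2 = four_block_mat ?R (0\<^sub>m (m + m2) 0) ?K (0\<^sub>m m1 0)"
    using K1 K2 M by (intro eq_matI) (auto simp: block_mat_def)
  have c: "?K \<in> carrier_mat m1 (m1 + (n + m2))" "?N \<in> carrier_mat (n + m2) (m1 + (n + m2))"
    "?X \<in> carrier_mat (m1 + (n + m2)) m1" "?Y \<in> carrier_mat (m1 + (n + m2)) (n + m2)"
    "?R \<in> carrier_mat (m + m2) (m1 + (n + m2))"
    by (rule carrier_matI; use K1 N1 X1(1) Y1(1) M in simp)+
  have tN: "transpose_mat ?N =
      four_block_mat (transpose_mat N1) (0\<^sub>m (n + m1) m2) (0\<^sub>m m2 n) (1\<^sub>m m2)"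
    using N1 by (subst transpose_four_block_mat[of _ n "n + m1" _ m2 _ m2]) auto
  have KX: "?K * ?X = 1\<^sub>m m1"
    using K1 X1 by (subst mult_four_block_mat[of _ m1 "n + m1" _ m2 _ 0 _ _ m1 _ 0])
      (auto intro!: eq_matI)
  have NY: "?N * ?Y = 1\<^sub>m (n + m2)"
    using N1 Y1 by (subst mult_four_block_mat[of _ n "n + m1" _ m2 _ m2 _ _ n _ m2]) auto
  have KN: "?K * transpose_mat ?N = 0\<^sub>m m1 (n + m2)"
    unfolding tN using K1 N1 KN1
    by (subst mult_four_block_mat[of _ m1 "n + m1" _ m2 _ 0 _ _ n _ m2]) (auto intro!: eq_matI)
  have RN: "?R * transpose_mat ?N = four_block_mat ?MN (transpose_mat K2) (0\<^sub>m 0 n) (0\<^sub>m 0 m2)"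
    unfolding tN using M N1 K2 MN
    by (subst mult_four_block_mat[of _ "m + m2" "n + m1" _ m2 _ 0 _ _ n _ m2]) auto
  have "unimodularly_equivalent (block_mat M K1 K2) (block_diag m1 (?R * transpose_mat ?N))"
    unfolding eq using stacked_equivalence[OF c(1,2,3,4) KX NY KN c(5)] .
  also have "?R * transpose_mat ?N =
      transpose_mat (four_block_mat (transpose_mat ?MN) (0\<^sub>m n 0) K2 (0\<^sub>m m2 0))"
    unfolding RN using MN K2 by (subst transpose_four_block_mat[of _ n "m + m2" _ 0 _ m2]) auto
  also have "unimodularly_equivalent (block_diag m1 \<dots>) (block_diag m1 (transpose_mat
      (block_diag m2 (transpose_mat ?MN * transpose_mat N2))))"
  proof (intro unimodularly_equivalent_block_diag unimodularly_equivalent_transpose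
      stacked_equivalence[where X = X2 and Y = Y2 and r = m])
    show "transpose_mat ?MN \<in> carrier_mat n (m2 + m)" using MN by (simp add: add.commute)
  qed (use K2 N2 X2 Y2 KN2 in \<open>auto simp: add.commute\<close>)
  also have "transpose_mat (block_diag m2 (transpose_mat ?MN * transpose_mat N2))
      = block_diag m2 (N2 * M * transpose_mat N1)"
  proof -
    have "transpose_mat ?MN * transpose_mat N2 = transpose_mat (N2 * ?MN)"
      using transpose_mult[OF N2 MN] by simp
    also have "N2 * ?MN = N2 * M * transpose_mat N1"
      using N2 M N1 by (simp add: assoc_mult_mat[of _ m "m + m2" _ "n + m1" _ n])
    finally have e: "transpose_mat ?MN * transpose_mat N2 = transpose_mat (N2 * M * transpose_mat N1)" .
    show ?thesis unfolding e using N2 N1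
      by (subst transpose_four_block_mat[of _ m2 m2 _ m _ n]) auto
  qed
  finally show ?thesis unfolding block_diag_block_diag .
qed

lemma block_mat_lification:
  fixes K1 N1 K2 N2 M :: "'a::field poly mat"
  assumes K1: "K1 \<in> carrier_mat m1 (n + m1)" and N1: "N1 \<in> carrier_mat n (n + m1)"
    and K2: "K2 \<in> carrier_mat m2 (m + m2)" and N2: "N2 \<in> carrier_mat m (m + m2)"
    and M: "M \<in> carrier_mat (m + m2) (n + m1)"
    and min: "minimal_rows d1 K1" "minimal_rows e1 N1" "minimal_rows d2 K2" "minimal_rows e2 N2"
    and KN1: "K1 * transpose_mat N1 = 0\<^sub>m m1 n" and KN2: "K2 * transpose_mat N2 = 0\<^sub>m m2 m"
    and deg: "0 < l" "mat_degree (block_mat M K1 K2) = l"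
  shows "lification l (block_mat M K1 K2) (N2 * M * transpose_mat N1)"
proof -
  from minimal_rows_right_inverse[OF min(1) K1] minimal_rows_right_inverse[OF min(2) N1]
    minimal_rows_right_inverse[OF min(3) K2] minimal_rows_right_inverse[OF min(4) N2]
  obtain X1 Y1 X2 Y2 where
    "X1 \<in> carrier_mat (n + m1) m1" "K1 * X1 = 1\<^sub>m m1"
    "Y1 \<in> carrier_mat (n + m1) n" "N1 * Y1 = 1\<^sub>m n"
    "X2 \<in> carrier_mat (m + m2) m2" "K2 * X2 = 1\<^sub>m m2"
    "Y2 \<in> carrier_mat (m + m2) m" "N2 * Y2 = 1\<^sub>m m"
    by blast
  from block_mat_equivalence[OF K1 N1 K2 N2 M this KN1 KN2] show ?thesis
    using deg unfolding lification_def unimodularly_equivalent_def by blast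
qed

lemma mat_degree_block_mat:
  assumes M: "M \<in> carrier_mat (dim_col K2) (dim_col K1)" and le: "mat_degree M \<le> l"
    and K: "\<And>K. K \<in> {K1, K2} \<Longrightarrow> dim_row K \<noteq> 0 \<Longrightarrow> mat_degree K = l"
    and nonempty: "dim_row K1 \<noteq> 0 \<or> dim_row K2 \<noteq> 0"
  shows "mat_degree (block_mat M K1 K2) = l"
proof -
  have *: "mat_degree (block_mat M K1 K2) \<le> d \<longleftrightarrow>
      mat_degree M \<le> d \<and> mat_degree K1 \<le> d \<and> mat_degree K2 \<le> d" for d
  proof -
    define p1 q1 p2 q2 where "p1 = dim_row K1" "q1 = dim_col K1" "p2 = dim_row K2" "q2 = dim_col K2"
    note c = this
    have "mat_degree (block_mat M K1 K2) \<le> d" if "mat_degree M \<le> d" "mat_degree K1 \<le> d" "mat_degree K2 \<le> d"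
      using that M by (auto simp: mat_degree_le_iff block_mat_def)
    moreover have "mat_degree M \<le> d" "mat_degree K1 \<le> d" "mat_degree K2 \<le> d"
      if "mat_degree (block_mat M K1 K2) \<le> d"
    proof -
      have entry: "degree (block_mat M K1 K2 $$ (i, j)) \<le> d" if "i < q2 + p1" "j < q1 + p2" for i j
        using \<open>mat_degree (block_mat M K1 K2) \<le> d\<close> that M
        by (auto simp: mat_degree_le_iff block_mat_def c)
      show "mat_degree M \<le> d"
        unfolding mat_degree_le_iff
      proof (intro allI impI)
        fix i j assume "i < dim_row M" "j < dim_col M"
        then show "degree (M $$ (i, j)) \<le> d" using entry[of i j] M by (simp add: c block_mat_def)
      qed
      show "mat_degree K1 \<le> d"
        unfolding mat_degree_le_iff
      proof (intro allI impI)
        fix i j assume "i < dim_row K1" "j < dim_col K1"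
        then show "degree (K1 $$ (i, j)) \<le> d"
          using entry[of "q2 + i" j] M by (simp add: c block_mat_def)
      qed
      show "mat_degree K2 \<le> d"
        unfolding mat_degree_le_iff
      proof (intro allI impI)
        fix i j assume "i < dim_row K2" "j < dim_col K2"
        then show "degree (K2 $$ (i, j)) \<le> d"
          using entry[of j "q1 + i"] M by (simp add: c block_mat_def)
      qed
    qed
    ultimately show ?thesis by blast
  qed
  have K_le: "mat_degree K \<le> l" if "K \<in> {K1, K2}" for K
    using K[OF that] by (cases "dim_row K = 0") (auto simp: mat_degree_le_iff)
  have "\<exists>K\<in>{K1, K2}. mat_degree K = l" using K nonempty by blast
  then have "l \<le> mat_degree (block_mat M K1 K2)" using *[of "mat_degree (block_mat M K1 K2)"] by auto
  moreover have "mat_degree (block_mat M K1 K2) \<le> l" using * le K_le by simp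
  ultimately show ?thesis by simp
qed

section \<open>Block minimal bases matrix polynomials are strong \<open>\<ell>\<close>-ifications\<close>

theorem theorem4p2:
  fixes K1 N1 K2 N2 M L Q :: "'a::field poly mat"
    and m n m1 m2 l :: nat
  assumes K1: "K1 \<in> carrier_mat m1 (n + m1)" and N1: "N1 \<in> carrier_mat n (n + m1)"
    and dual1: "m1 \<noteq> 0 \<Longrightarrow> dual_minimal_bases K1 N1" and absent1: "m1 = 0 \<Longrightarrow> N1 = 1\<^sub>m n"
    and K2: "K2 \<in> carrier_mat m2 (m + m2)" and N2: "N2 \<in> carrier_mat m (m + m2)"
    and dual2: "m2 \<noteq> 0 \<Longrightarrow> dual_minimal_bases K2 N2" and absent2: "m2 = 0 \<Longrightarrow> N2 = 1\<^sub>m m"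
    and l: "0 < l"
    and M: "M \<in> carrier_mat (m + m2) (n + m1)"
    and block: "block_minimal_bases l M K1 K2"
    and L: "L = block_mat M K1 K2"
    and Q: "Q = N2 * M * transpose_mat N1"
  shows "lification l L Q \<and>
    (strong_block_minimal_bases l M K1 K2 \<longrightarrow>
      strong_lification l (l + mat_degree N1 + mat_degree N2) L Q)"
proof (intro conjI impI)
  have M': "M \<in> carrier_mat (dim_col K2) (dim_col K1)" and Ml: "mat_degree M \<le> l"
    and nonempty: "dim_row K1 \<noteq> 0 \<or> dim_row K2 \<noteq> 0"
    and degK: "\<And>K. K \<in> {K1, K2} \<Longrightarrow> dim_row K \<noteq> 0 \<Longrightarrow> mat_degree K = l"
    using block by (auto simp: block_minimal_bases_def)
  note KN1 = dual_pair_minimal_rows(3)[OF K1 N1 dual1 absent1]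
  note KN2 = dual_pair_minimal_rows(3)[OF K2 N2 dual2 absent2]
  obtain d1 e1 d2 e2 where
    "minimal_rows d1 K1" "minimal_rows e1 N1" "minimal_rows d2 K2" "minimal_rows e2 N2"
    using dual_pair_minimal_rows(1,2)[OF K1 N1 dual1 absent1]
      dual_pair_minimal_rows(1,2)[OF K2 N2 dual2 absent2] by blast
  from block_mat_lification[OF K1 N1 K2 N2 M this KN1 KN2 l mat_degree_block_mat[OF M' Ml degK nonempty]]
  show lif: "lification l L Q" unfolding L Q .
  assume strong: "strong_block_minimal_bases l M K1 K2"
  define \<epsilon>1 \<epsilon>2 where "\<epsilon>1 = mat_degree N1" and "\<epsilon>2 = mat_degree N2"
  have min: "minimal_rows (\<lambda>_. l) K1" "minimal_rows (\<lambda>_. \<epsilon>1) N1"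
    "minimal_rows (\<lambda>_. l) K2" "minimal_rows (\<lambda>_. \<epsilon>2) N2"
    unfolding \<epsilon>1_def \<epsilon>2_def
    using strong strong_dual_pair_minimal_rows[OF K1 N1 dual1 absent1, of l]
      strong_dual_pair_minimal_rows[OF K2 N2 dual2 absent2, of l]
    by (simp_all add: strong_block_minimal_bases_def)
  have K_le: "mat_degree K1 \<le> l" "mat_degree K2 \<le> l"
    using minimal_rows_degree_le[OF min(1)] minimal_rows_degree_le[OF min(3)]
    by (auto simp: mat_degree_le_iff)
  have N_le: "mat_degree N1 \<le> \<epsilon>1" "mat_degree N2 \<le> \<epsilon>2" by (simp_all add: \<epsilon>1_def \<epsilon>2_def)
  have N1T: "transpose_mat N1 \<in> carrier_mat (n + m1) n" "mat_degree (transpose_mat N1) \<le> \<epsilon>1"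
    using N1 N_le by (simp_all add: mat_degree_transpose)
  have N2T: "transpose_mat N2 \<in> carrier_mat (m + m2) m" "mat_degree (transpose_mat N2) \<le> \<epsilon>2"
    using N2 N_le by (simp_all add: mat_degree_transpose)
  have N2M: "N2 * M \<in> carrier_mat m (n + m1)" "mat_degree (N2 * M) \<le> \<epsilon>2 + l"
    using N2 M mat_degree_mult_le[OF N2 M N_le(2) Ml] by simp_all
  have revQ: "mat_rev (\<epsilon>2 + l + \<epsilon>1) Q = mat_rev \<epsilon>2 N2 * mat_rev l M * transpose_mat (mat_rev \<epsilon>1 N1)"
    unfolding Q mat_rev_mult[OF N2M(1) N1T(1) N2M(2) N1T(2)] mat_rev_mult[OF N2 M N_le(2) Ml]
      mat_rev_transpose ..
  have revL: "mat_rev l L = block_mat (mat_rev l M) (mat_rev l K1) (mat_rev l K2)"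
    unfolding L by (rule mat_rev_block_mat[OF M'])
  note revmin = minimal_rows_rev[OF min(1)] minimal_rows_rev[OF min(2)]
    minimal_rows_rev[OF min(3)] minimal_rows_rev[OF min(4)]
  have KN1': "mat_rev l K1 * transpose_mat (mat_rev \<epsilon>1 N1) = 0\<^sub>m m1 n"
    using mat_rev_mult[OF K1 N1T(1) K_le(1) N1T(2)] KN1 by (simp add: mat_rev_transpose)
  have KN2': "mat_rev l K2 * transpose_mat (mat_rev \<epsilon>2 N2) = 0\<^sub>m m2 m"
    using mat_rev_mult[OF K2 N2T(1) K_le(2) N2T(2)] KN2 by (simp add: mat_rev_transpose)
  \<comment> \<open>Reversal could lower the degree of \<open>L\<close>, but the reversed blocks still attain the bound \<open>l\<close>.\<close>
  have "mat_degree (mat_rev l L) = l"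
    unfolding revL
  proof (rule mat_degree_block_mat)
    show "mat_degree K = l" if "K \<in> {mat_rev l K1, mat_rev l K2}" "dim_row K \<noteq> 0" for K
      using that revmin(1,3) minimal_rows_mat_degree by blast
  qed (use M' nonempty in \<open>auto simp: mat_degree_mat_rev_le\<close>)
  with block_mat_lification[OF _ _ _ _ _ revmin KN1' KN2' l] K1 N1 K2 N2 M
  have "lification l (mat_rev l L) (mat_rev (\<epsilon>2 + l + \<epsilon>1) Q)"
    unfolding revQ revL by simp
  moreover have "\<epsilon>2 + l + \<epsilon>1 = l + mat_degree N1 + mat_degree N2" by (simp add: \<epsilon>1_def \<epsilon>2_def)
  moreover have "mat_degree Q \<le> \<epsilon>2 + l + \<epsilon>1"
    unfolding Q by (rule mat_degree_mult_le[OF N2M(1) N1T(1) N2M(2) N1T(2)])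
  ultimately show "strong_lification l (l + mat_degree N1 + mat_degree N2) L Q"
    using lif by (simp add: strong_lification_def)
qed

end
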